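(* Let $(C,d)$ be an equitising $\zeta$-regular ultrametric Cantor set whose Connes measure $\mu_\tau$ has support $C$ and is an equity measure, and assume that $s<4$. Let $(\phi_\lambda)$ be an $L^2(C,\mu_\tau)$-orthonormal eigenbasis of the Vladimirov-Pearson operator $\mathcal{D}^s$ consisting of functions in $\mathcal{D}(C)$, indexed by the eigenvalues $\lambda$ of $\mathcal{D}^s$ counted with multiplicity. Then the Green function associated with $-\mathcal{D}^s$ exists and has the form \[ G(x,y)=\sum_{\lambda>0}\lambda^{-1}\phi_\lambda(x)\overline{\phi_\lambda(y)} \] for $x,y\in C$, provided the sum \[ \sum_{\lambda>0}\lambda^{-1} \] over the positive eigenvalues of $\mathcal{D}^s$ (counted with multiplicity) is convergent.
   Context: A Cantor set is a totally disconnected compact metrisable space without isolated points. A regular ultrametric Cantor set $(C,d)$ is a Cantor set $C$ with an ultrametric $d$ generating its topology. Its Michon tree $T(C)$ is the rooted tree whose vertices $v\in V$ are in bijection with the balls (discs) $[v]\subseteq C$ for $d$; the root is $C$, and the children of $v$ are the maximal balls properly contained in $[v]$ (finitely many, at least two). $\mathcal{D}(C)$ is the space of test functions, i.e. locally constant functions $C\to\mathbb{C}$. $(C,d)$ is equitising if all children $u$ of any given vertex have the same $\operatorname{diam}([u])$. Dirac operator and zeta function. On $\mathcal{H}=\ell^2(V)\otimes\mathbb{C}^2$ put $D\psi(v)=\operatorname{diam}([v])^{-1}\sigma_1\psi(v)$ with $\sigma_1=\begin{pmatrix}0&1\\1&0\end{pmatrix}$, so $|D|\psi(v)=\operatorname{diam}([v])^{-1}\psi(v)$,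 and $\zeta(s)=\frac12\operatorname{Tr}(|D|^{-s})=\sum_{v\in V}\operatorname{diam}([v])^s$. A choice function is a map $\tau=(\tau_+,\tau_-):V\to C\times C$ with $\tau(v)\in[v]\times[v]$ and $d(\tau_+(v),\tau_-(v))=\operatorname{diam}([v])$; the set of choice functions is $\Upsilon(C)$. For $f$ continuous on $C$, $\pi_\tau(f)\psi(v)=\operatorname{diag}(f(\tau_+(v)),f(\tau_-(v)))\psi(v)$. $(C,d)$ is $\zeta$-regular if $\zeta(s)$ has an abscissa of convergence $s_0\in\mathbb{R}$ (converges for $\Re(s)>s_0$) and $\lim_{s\downarrow s_0}(s-s_0)\operatorname{Tr}(|D|^{-s}\pi_\tau(f))$ exists for all continuous $f$ and all $\tau\in\Upsilon(C)$. Connes measure. For $\zeta$-regular $(C,d)$, the Connes measure $\mu_\tau$ is the Borel probability measure on $C$ (independent of $\tau$) given by $\int_C f\,d\mu_\tau=\lim_{s\downarrow s_0}\operatorname{Tr}(|D|^{-s}\pi_\tau(f))/\operatorname{Tr}(|D|^{-s})$ for continuous $f$. It is an equity measure if for every vertex $v_0$ the value $\mu_\tau([v])$ is the same for all children $v$ of $v_0$. Vladimirov-Pearson operator. Assume $\operatorname{supp}\mu_\tau=C$. Identify $\Upsilon(C)=\prod_{v\in V}\Upsilon_v$ with $\Upsilon_v=\{(x,y)\in[v]^2: d(x,y)=\operatorname{diam}([v])\}$, and let $\nu$ be the product of the probability measures obtained by normalising the restriction of $\mu_\tau\times\mu_\tau$ to $\Upsilon_v$. For $s\in\mathbb{R}$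 and $f,g\in\mathcal{D}(C)$ let \[Q_s(f,g)=\tfrac12\int_{\Upsilon(C)}\operatorname{Tr}\{|D|^{-s}[D,\pi_\tau(f)]^*[D,\pi_\tau(g)]\}\,d\nu(\tau),\] a closable Dirichlet form on $L^2(C,\mu_\tau)$, and let $\Delta_s$ be the associated self-adjoint non-positive operator, $\langle-\Delta_sf,g\rangle=Q_s(f,g)$ in $L^2(C,\mu_\tau)$. The Vladimirov-Pearson operator is \[\mathcal{D}^sf(z)=\tfrac12\lim_{v\to z}\mu_\tau([v])^{-1}\langle 1_{[v]},-\Delta_sf\rangle,\quad f\in\mathcal{D}(C),\] where $v\to z$ means that $[v]$ runs through the discs containing $z$, shrinking to $\{z\}$. As an operator on $L^2(C,\mu_\tau)$, $\mathcal{D}^s$ is understood as the closure of this operator with initial domain $\mathcal{D}(C)$. Green function. With $h(t,x,y)=\sum_{\lambda>0}e^{-t\lambda}\phi_\lambda(x)\overline{\phi_\lambda(y)}$ (sum over positive eigenvalues with multiplicity), the Green function associated with $-\mathcal{D}^s$ is $G(x,y)=\int_0^\infty h(t,x,y)\,dt$.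
   Formalization: G(x,x) can be infinite at exceptional points, so the formula is proved as stated where the diagonal sums are finite (almost everywhere); for x≠y in general the sum is grouped by distinct eigenvalues, and for x=y the identity holds in [0,∞]. *)

theory Defs
  imports "HOL-Probability.Probability"
begin

text \<open>The Cantor set \<open>C\<close> is the carrier of a metric type \<open>'a\<close> (so it is nonempty, and its topology
  is the one generated by \<open>dist\<close>).\<close>

definition ultrametric_cantor :: "'a::metric_space itself \<Rightarrow> bool" where
  "ultrametric_cantor _ \<longleftrightarrow>
     compact (UNIV :: 'a set) \<and>
     (\<forall>S :: 'a set. connected S \<longrightarrow> (\<exists>x. S \<subseteq> {x})) \<and>
     (\<forall>x :: 'a. x islimpt UNIV) \<and>
     (\<forall>x y z :: 'a. dist x z \<le> max (dist x y) (dist y z))"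


section \<open>The Michon tree\<close>

text \<open>Vertices are identified with the balls of positive radius, regarded as sets of points: in a
  compact ultrametric space without isolated points the open and the closed balls of positive
  radius form the same family of sets.\<close>

definition michon_vertices :: "'a::metric_space set set" where
  "michon_vertices = {cball x r | x r. r > 0}"

definition michon_children :: "'a::metric_space set \<Rightarrow> 'a set set" where
  "michon_children v =
     {u \<in> michon_vertices. u \<subset> v \<and> (\<forall>w \<in> michon_vertices. u \<subseteq> w \<and> w \<subset> v \<longrightarrow> w = u)}"

definition equitising :: "'a::metric_space itself \<Rightarrow> bool" where
  "equitising _ \<longleftrightarrow>
     (\<forall>v \<in> (michon_vertices :: 'a set set). \<forall>u \<in> michon_children v. \<forall>w \<in> michon_children v.
        diameter u = diameter w)"

definition test_functions :: "('a::metric_space \<Rightarrow> complex) set" where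
  "test_functions = {f. \<forall>x. \<exists>U. open U \<and> x \<in> U \<and> f constant_on U}"


section \<open>Dirac operator, choice functions, zeta-regularity\<close>

text \<open>Every operator on \<open>\<ell>\<^sup>2(V) \<otimes> \<complex>\<^sup>2\<close> needed here is decomposable, \<open>(A \<psi>)(v) = A(v) \<psi>(v)\<close>; it is
  represented by its field \<open>v \<mapsto> A(v)\<close> of \<open>2 \<times> 2\<close> matrices, so that products and adjoints are
  fibrewise, and the trace is the sum over the vertices of the traces of the fibres.\<close>

type_synonym 'a fibre_op = "'a set \<Rightarrow> complex^2^2"

definition sigma1 :: "complex^2^2" where
  "sigma1 = vector [vector [0, 1], vector [1, 0]]"

definition conj_transpose :: "complex^2^2 \<Rightarrow> complex^2^2" where
  "conj_transpose A = (\<chi> i j. cnj (A $ j $ i))"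

definition op_mult :: "'a fibre_op \<Rightarrow> 'a fibre_op \<Rightarrow> 'a fibre_op" where
  "op_mult A B = (\<lambda>v. A v ** B v)"

definition op_adjoint :: "'a fibre_op \<Rightarrow> 'a fibre_op" where
  "op_adjoint A = (\<lambda>v. conj_transpose (A v))"

definition op_commutator :: "'a fibre_op \<Rightarrow> 'a fibre_op \<Rightarrow> 'a fibre_op" where
  "op_commutator A B = (\<lambda>v. A v ** B v - B v ** A v)"

definition op_trace :: "'a::metric_space fibre_op \<Rightarrow> complex" where
  "op_trace A = (\<Sum>\<^sub>\<infinity>v \<in> michon_vertices. trace (A v))"

definition dirac :: "'a::metric_space fibre_op" where
  "dirac v = inverse (diameter v) *\<^sub>R sigma1"

definition abs_dirac_powr :: "complex \<Rightarrow> 'a::metric_space fibre_op" where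
  "abs_dirac_powr z v = mat (complex_of_real (inverse (diameter v)) powr z)"

definition choice_pairs :: "'a::metric_space set \<Rightarrow> ('a \<times> 'a) set" where
  "choice_pairs v = {(x, y). x \<in> v \<and> y \<in> v \<and> dist x y = diameter v}"

definition choice_functions :: "('a::metric_space set \<Rightarrow> 'a \<times> 'a) set" where
  "choice_functions = (\<Pi>\<^sub>E v \<in> michon_vertices. choice_pairs v)"

definition choice_rep ::
    "('a::metric_space set \<Rightarrow> 'a \<times> 'a) \<Rightarrow> ('a \<Rightarrow> complex) \<Rightarrow> 'a fibre_op" where
  "choice_rep \<tau> f v = vector [vector [f (fst (\<tau> v)), 0], vector [0, f (snd (\<tau> v))]]"

text \<open>The abscissa of convergence of \<open>\<zeta>(z) = \<Sum>\<^sub>v diam([v])\<^sup>z\<close>.\<close>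

definition zeta_abscissa :: "'a::metric_space itself \<Rightarrow> real \<Rightarrow> bool" where
  "zeta_abscissa _ s0 \<longleftrightarrow>
     (\<forall>z. Re z > s0 \<longrightarrow>
        (\<lambda>v :: 'a set. complex_of_real (diameter v) powr z) summable_on michon_vertices) \<and>
     (\<forall>z. Re z < s0 \<longrightarrow>
        \<not> (\<lambda>v :: 'a set. complex_of_real (diameter v) powr z) summable_on michon_vertices)"

definition zeta_regular :: "'a::metric_space itself \<Rightarrow> real \<Rightarrow> bool" where
  "zeta_regular T s0 \<longleftrightarrow> zeta_abscissa T s0 \<and>
     (\<forall>f :: 'a \<Rightarrow> complex. continuous_on UNIV f \<longrightarrow>
        (\<forall>\<tau> \<in> choice_functions. \<exists>L.
           ((\<lambda>s. of_real (s - s0) *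
               op_trace (op_mult (abs_dirac_powr (- of_real s)) (choice_rep \<tau> f))) \<longlongrightarrow> L)
             (at_right s0)))"


section \<open>Connes measure\<close>

definition connes_measure :: "real \<Rightarrow> 'a::metric_space measure \<Rightarrow> bool" where
  "connes_measure s0 \<mu> \<longleftrightarrow> prob_space \<mu> \<and> sets \<mu> = sets borel \<and>
     (\<forall>\<tau> \<in> choice_functions. \<forall>f :: 'a \<Rightarrow> complex. continuous_on UNIV f \<longrightarrow>
        ((\<lambda>s. op_trace (op_mult (abs_dirac_powr (- of_real s)) (choice_rep \<tau> f)) /
              op_trace (abs_dirac_powr (- of_real s) :: 'a fibre_op))
           \<longlongrightarrow> integral\<^sup>L \<mu> f) (at_right s0))"

definition measure_support :: "'a::topological_space measure \<Rightarrow> 'a set" where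
  "measure_support \<mu> = {x. \<forall>U. open U \<and> x \<in> U \<longrightarrow> emeasure \<mu> U \<noteq> 0}"

definition equity_measure :: "'a::metric_space measure \<Rightarrow> bool" where
  "equity_measure \<mu> \<longleftrightarrow>
     (\<forall>v \<in> michon_vertices. \<forall>u \<in> michon_children v. \<forall>w \<in> michon_children v.
        measure \<mu> u = measure \<mu> w)"


section \<open>The Vladimirov-Pearson operator\<close>

text \<open>The factor of \<open>\<nu>\<close> at \<open>v\<close> lives on \<open>\<Upsilon>\<^sub>v\<close> itself, so that the space of \<open>\<nu>\<close> is \<open>\<Upsilon>(C)\<close>.\<close>

definition choice_measure ::
    "'a::metric_space measure \<Rightarrow> ('a set \<Rightarrow> 'a \<times> 'a) measure" where
  "choice_measure \<mu> =
     (\<Pi>\<^sub>M v \<in> michon_vertices.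
        restrict_space (uniform_measure (\<mu> \<Otimes>\<^sub>M \<mu>) (choice_pairs v)) (choice_pairs v))"

definition pearson_form ::
    "'a::metric_space measure \<Rightarrow> real \<Rightarrow> ('a \<Rightarrow> complex) \<Rightarrow> ('a \<Rightarrow> complex) \<Rightarrow> complex" where
  "pearson_form \<mu> s f g = 1/2 *
     (LINT \<tau> | choice_measure \<mu>.
        op_trace (op_mult (abs_dirac_powr (- of_real s))
          (op_mult (op_adjoint (op_commutator dirac (choice_rep \<tau> f)))
                   (op_commutator dirac (choice_rep \<tau> g)))))"

definition L2_functions :: "'a measure \<Rightarrow> ('a \<Rightarrow> complex) set" where
  "L2_functions \<mu> = {f \<in> borel_measurable \<mu>. integrable \<mu> (\<lambda>x. (norm (f x))\<^sup>2)}"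

text \<open>Antilinear in the first argument, matching the adjoint on \<open>[D, \<pi>\<^sub>\<tau>(f)]\<close> in the form.\<close>

definition L2_inner :: "'a measure \<Rightarrow> ('a \<Rightarrow> complex) \<Rightarrow> ('a \<Rightarrow> complex) \<Rightarrow> complex" where
  "L2_inner \<mu> f g = (LINT x | \<mu>. cnj (f x) * g x)"

definition L2_sqdist :: "'a measure \<Rightarrow> ('a \<Rightarrow> complex) \<Rightarrow> ('a \<Rightarrow> complex) \<Rightarrow> ennreal" where
  "L2_sqdist \<mu> f g = (\<integral>\<^sup>+ x. ennreal ((norm (f x - g x))\<^sup>2) \<partial>\<mu>)"

text \<open>A representative of \<open>-\<Delta>\<^sub>s f\<close> for a test function \<open>f\<close>, determined almost everywhere by
  \<open>\<langle>-\<Delta>\<^sub>s f, g\<rangle> = Q\<^sub>s(f, g)\<close>. Testing against test functions \<open>g\<close> suffices, since they are a core of the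
  closed form and dense in \<open>L\<^sup>2\<close>.\<close>

definition neg_laplacian ::
    "'a::metric_space measure \<Rightarrow> real \<Rightarrow> ('a \<Rightarrow> complex) \<Rightarrow> 'a \<Rightarrow> complex" where
  "neg_laplacian \<mu> s f = (SOME h. h \<in> L2_functions \<mu> \<and>
     (\<forall>g \<in> test_functions. L2_inner \<mu> h g = pearson_form \<mu> s f g))"

definition discs_shrinking_to :: "'a::metric_space \<Rightarrow> 'a set filter" where
  "discs_shrinking_to z =
     (INF r \<in> {0<..}. principal {v \<in> michon_vertices. z \<in> v \<and> diameter v < r})"

definition vladimirov_pearson ::
    "'a::metric_space measure \<Rightarrow> real \<Rightarrow> ('a \<Rightarrow> complex) \<Rightarrow> 'a \<Rightarrow> complex" where
  "vladimirov_pearson \<mu> s f z = 1/2 *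
     Lim (discs_shrinking_to z)
       (\<lambda>v. L2_inner \<mu> (indicator v) (neg_laplacian \<mu> s f) / of_real (measure \<mu> v))"

text \<open>The graph of the closure in \<open>L\<^sup>2(C, \<mu>)\<close> of the operator with initial domain \<open>\<D>(C)\<close>;
  functions are representatives of \<open>L\<^sup>2\<close>-classes.\<close>

definition vladimirov_pearson_closure ::
    "'a::metric_space measure \<Rightarrow> real \<Rightarrow> (('a \<Rightarrow> complex) \<times> ('a \<Rightarrow> complex)) set" where
  "vladimirov_pearson_closure \<mu> s =
     {(f, g). f \<in> L2_functions \<mu> \<and> g \<in> L2_functions \<mu> \<and>
        (\<exists>F :: nat \<Rightarrow> 'a \<Rightarrow> complex. (\<forall>n. F n \<in> test_functions) \<and>
           (\<lambda>n. L2_sqdist \<mu> (F n) f) \<longlonglongrightarrow> 0 \<and>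
           (\<lambda>n. L2_sqdist \<mu> (vladimirov_pearson \<mu> s (F n)) g) \<longlonglongrightarrow> 0)}"

definition vp_test_eigenbasis ::
    "'a::metric_space measure \<Rightarrow> real \<Rightarrow> 'i set \<Rightarrow> ('i \<Rightarrow> real) \<Rightarrow> ('i \<Rightarrow> 'a \<Rightarrow> complex) \<Rightarrow> bool" where
  "vp_test_eigenbasis \<mu> s I eig \<phi> \<longleftrightarrow>
     (\<forall>i \<in> I. \<phi> i \<in> test_functions \<and>
        (\<phi> i, \<lambda>x. of_real (eig i) * \<phi> i x) \<in> vladimirov_pearson_closure \<mu> s) \<and>
     (\<forall>i \<in> I. \<forall>j \<in> I. L2_inner \<mu> (\<phi> i) (\<phi> j) = (if i = j then 1 else 0)) \<and>
     (\<forall>f \<in> L2_functions \<mu>. \<forall>e > 0. \<exists>J c. finite J \<and> J \<subseteq> I \<and>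
        L2_sqdist \<mu> f (\<lambda>x. \<Sum>j \<in> J. c j * \<phi> j x) < e)"


section \<open>Heat kernel and Green function\<close>

definition pos_indices :: "'i set \<Rightarrow> ('i \<Rightarrow> real) \<Rightarrow> 'i set" where
  "pos_indices I eig = {i \<in> I. 0 < eig i}"

definition heat_term ::
    "('i \<Rightarrow> real) \<Rightarrow> ('i \<Rightarrow> 'a \<Rightarrow> complex) \<Rightarrow> real \<Rightarrow> 'a \<Rightarrow> 'a \<Rightarrow> 'i \<Rightarrow> complex" where
  "heat_term eig \<phi> t x y i = of_real (exp (- t * eig i)) * \<phi> i x * cnj (\<phi> i y)"

definition heat_kernel ::
    "'i set \<Rightarrow> ('i \<Rightarrow> real) \<Rightarrow> ('i \<Rightarrow> 'a \<Rightarrow> complex) \<Rightarrow> real \<Rightarrow> 'a \<Rightarrow> 'a \<Rightarrow> complex" where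
  "heat_kernel I eig \<phi> t x y = (\<Sum>\<^sub>\<infinity>i \<in> pos_indices I eig. heat_term eig \<phi> t x y i)"

definition green_function ::
    "'i set \<Rightarrow> ('i \<Rightarrow> real) \<Rightarrow> ('i \<Rightarrow> 'a \<Rightarrow> complex) \<Rightarrow> 'a \<Rightarrow> 'a \<Rightarrow> complex" where
  "green_function I eig \<phi> x y = (LBINT t:{0<..}. heat_kernel I eig \<phi> t x y)"

definition green_exists ::
    "'i set \<Rightarrow> ('i \<Rightarrow> real) \<Rightarrow> ('i \<Rightarrow> 'a \<Rightarrow> complex) \<Rightarrow> 'a \<Rightarrow> 'a \<Rightarrow> bool" where
  "green_exists I eig \<phi> x y \<longleftrightarrow> set_integrable lborel {0<..} (\<lambda>t. heat_kernel I eig \<phi> t x y)"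

definition green_term ::
    "('i \<Rightarrow> real) \<Rightarrow> ('i \<Rightarrow> 'a \<Rightarrow> complex) \<Rightarrow> 'a \<Rightarrow> 'a \<Rightarrow> 'i \<Rightarrow> complex" where
  "green_term eig \<phi> x y i = of_real (inverse (eig i)) * \<phi> i x * cnj (\<phi> i y)"

text \<open>The points with \<open>G(x, x) < \<infinity>\<close>. The hypotheses only force almost every point to be of this
  kind: along a branch on which the diameters decrease slowly, \<open>\<Sum> \<lambda>\<^sup>-\<^sup>1 |\<phi>\<^sub>\<lambda>(x)|\<^sup>2\<close> may diverge
  although \<open>\<Sum> \<lambda>\<^sup>-\<^sup>1\<close> converges.\<close>

definition green_diag_finite ::
    "'i set \<Rightarrow> ('i \<Rightarrow> real) \<Rightarrow> ('i \<Rightarrow> 'a \<Rightarrow> complex) \<Rightarrow> 'a set" where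
  "green_diag_finite I eig \<phi> =
     {x. (\<lambda>i. inverse (eig i) * (norm (\<phi> i x))\<^sup>2) summable_on pos_indices I eig}"

end

theory Submission
  imports Defs
begin

text \<open>A test function is constant on all balls of some radius \<open>r\<close>, so it is only seen by the finitely many
vertices of diameter at least \<open>r\<close>. For such a function the integral over choice functions collapses to
a finite sum of Dirichlet energies, one for each vertex \<open>v\<close>, over the pairs in \<open>v\<close> at distance
\<open>diam v\<close> (\<open>pearson_form_eq\<close>). Fubini turns each energy into an integral operator
(\<open>pair_energy_eq\<close>), and since all children of a vertex have the same mass this operator has the simple
form of \<open>vertex_laplacian\<close>. Hence \<open>vladimirov_pearson\<close> is an explicit symmetric operator on test
functions (\<open>vladimirov_pearson_eq\<close>, \<open>vladimirov_pearson_symmetric\<close>).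

The balls containing a point \<open>x\<close> form a branch \<open>C = b\<^sub>0 \<supset> b\<^sub>1 \<supset> \<dots>\<close>. With \<open>e\<^sub>k\<close> the indicator of
\<open>b\<^sub>k\<close> divided by its mass, the Haar function \<open>h\<^sub>k = e\<^bsub>k+1\<^esub> - e\<^sub>k\<close> of the branch is an eigenfunction
(\<open>vladimirov_pearson_haar\<close>); its eigenvalue \<open>\<lambda>\<^sub>k(x)\<close> is positive and depends only on \<open>b\<^sub>k\<close>. By symmetry,
a member \<open>\<phi>\<^sub>i\<close> of the eigenbasis is orthogonal to every Haar function with an eigenvalue different from
\<open>\<lambda>\<^sub>i\<close>, although \<open>\<phi>\<^sub>i\<close> only satisfies the eigenvalue equation for the closure
(\<open>closure_weak_eigen\<close>). Pairing \<open>\<phi>\<^sub>i\<close> with \<open>e\<^sub>n = 1 + h\<^sub>0 + \<dots> + h\<^bsub>n-1\<^esub>\<close> recovers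
\<open>\<phi>\<^sub>i(x)\<close> for large \<open>n\<close>, and expanding \<open>h\<^sub>k\<close> in the eigenbasis gives the identity on which all else rests
(\<open>eigenspace_kernel\<close>): for \<open>l > 0\<close> and large \<open>n\<close>,
\<open>\<Sum>{\<phi>\<^sub>i(y) cnj \<phi>\<^sub>i(x) | \<lambda>\<^sub>i = l} = \<Sum>{h\<^sub>k(y) | k < n, \<lambda>\<^sub>k(x) = l}\<close>.

Off the diagonal only finitely many \<open>h\<^sub>k(y)\<close> are nonzero, so the heat kernel is a finite sum of decaying
exponentials, and its integral can be computed term by term (\<open>green_off_diagonal\<close>).

On the diagonal, \<open>\<Sum> exp(-t \<lambda>\<^sub>i) |\<phi>\<^sub>i(x)|\<^sup>2\<close> becomes \<open>\<Sum> exp(-t \<lambda>\<^sub>k(x)) h\<^sub>k(x)\<close>. To bound it, the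
convergence of \<open>\<Sum> 1/\<lambda>\<^sub>i\<close> is used twice. It forces \<open>s < 2\<close>: otherwise \<open>\<lambda>\<^sub>k(x)\<close> is at most a
constant times \<open>h\<^sub>k(x)\<close> and \<open>\<Sum> |\<phi>\<^sub>i(x)|\<^sup>2/\<lambda>\<^sub>i\<close> diverges everywhere (\<open>exponent_less_2\<close>). For
\<open>s < 2\<close> the eigenvalue \<open>\<lambda>\<^sub>k(x)\<close> is at least a constant times \<open>1/\<mu>(b\<^sub>k)\<close>, hence grows like
\<open>2\<^sup>k\<close> or faster. Convergence also bounds the multiplicity of \<open>\<lambda>\<^sub>k(x)\<close>, and thereby \<open>h\<^sub>k(x)\<close>, by a
multiple of \<open>\<lambda>\<^sub>k(x)/\<mu>(b\<^sub>k)\<close> (\<open>haar_diag_le\<close>). So the heat kernel converges absolutely at every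
pair of points. Tonelli's theorem then yields the finiteness almost everywhere and the identity on the
diagonal, and Fubini's theorem (\<open>laplace_sum\<close>) the expansion at points with finite diagonal.\<close>

section \<open>Sums of decaying exponentials\<close>

text \<open>Makes Tonelli's theorem for the counting measure available for
unordered sums of extended nonnegative reals.\<close>

lemma nn_integral_count_space_eq_infsum:
  fixes f :: "'i \<Rightarrow> ennreal"
  assumes "countable A"
  shows "(\<integral>\<^sup>+i. f i \<partial>count_space A) = (\<Sum>\<^sub>\<infinity>i\<in>A. f i)"
proof (rule antisym)
  have sup: "(\<Sum>\<^sub>\<infinity>i\<in>A. f i) = (SUP F\<in>{F. finite F \<and> F \<subseteq> A}. sum f F)"
    by (rule nonneg_infsum_complete) auto
  show "(\<Sum>\<^sub>\<infinity>i\<in>A. f i) \<le> (\<integral>\<^sup>+i. f i \<partial>count_space A)"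
    unfolding sup
  proof (intro SUP_least)
    fix F assume "F \<in> {F. finite F \<and> F \<subseteq> A}"
    then have F: "finite F" "F \<subseteq> A" by auto
    have "sum f F = (\<integral>\<^sup>+i. f i \<partial>count_space F)" using F by (simp add: nn_integral_count_space_finite)
    also have "\<dots> = (\<integral>\<^sup>+i. f i * indicator F i \<partial>count_space A)"
      using F by (subst nn_integral_restrict_space[symmetric]) (auto simp: restrict_count_space_subset)
    also have "\<dots> \<le> (\<integral>\<^sup>+i. f i \<partial>count_space A)"
      by (intro nn_integral_mono) (auto simp: indicator_def)
    finally show "sum f F \<le> \<dots>" .
  qed
  show "(\<integral>\<^sup>+i. f i \<partial>count_space A) \<le> (\<Sum>\<^sub>\<infinity>i\<in>A. f i)"
  proof (cases "finite A")
    case True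
    then show ?thesis by (simp add: nn_integral_count_space_finite)
  next
    case False
    have b: "bij_betw (from_nat_into A) UNIV A" using assms False by (rule bij_betw_from_nat_into)
    have "(\<integral>\<^sup>+i. f i \<partial>count_space A) = (\<Sum>n. f (from_nat_into A n))"
      using nn_integral_bij_count_space[OF b, of f] by (simp add: nn_integral_count_space_nat)
    also have "\<dots> = (SUP n. \<Sum>k<n. f (from_nat_into A k))"
      by (rule suminf_eq_SUP)
    also have "\<dots> \<le> (\<Sum>\<^sub>\<infinity>i\<in>A. f i)"
    proof (rule SUP_least)
      fix n
      have "(\<Sum>k<n. f (from_nat_into A k)) = sum f (from_nat_into A ` {..<n})"
        using b by (subst sum.reindex) (auto simp: bij_betw_def inj_on_def)
      then show "(\<Sum>k<n. f (from_nat_into A k)) \<le> (\<Sum>\<^sub>\<infinity>i\<in>A. f i)"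
        unfolding sup using b by (auto simp: bij_betw_def intro!: SUP_upper)
    qed
    finally show ?thesis .
  qed
qed

lemma nn_integral_exp_decay:
  fixes l :: real
  assumes "l > 0"
  shows "(\<integral>\<^sup>+t\<in>{0<..}. ennreal (exp (- t * l)) \<partial>lborel) = ennreal (1 / l)"
proof -
  have "(\<integral>\<^sup>+t\<in>{0<..}. ennreal (exp (- t * l)) \<partial>lborel) = (\<integral>\<^sup>+t. ennreal (exp (- t * l)) * indicator {0..} t \<partial>lborel)"
    using AE_lborel_singleton[of 0] by (intro nn_integral_cong_AE) (auto elim!: eventually_mono simp: indicator_def)
  also have "\<dots> = ennreal (0 - (- exp (- 0 * l) / l))"
  proof (rule nn_integral_FTC_atLeast)
    show "((\<lambda>t. - exp (- t * l) / l) \<longlongrightarrow> 0) at_top"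
    proof -
      have "filterlim (\<lambda>t. l * t) at_top at_top"
        by (rule filterlim_tendsto_pos_mult_at_top[OF tendsto_const assms filterlim_ident])
      then have "((\<lambda>t. exp (- (l * t))) \<longlongrightarrow> 0) at_top"
        by (intro filterlim_compose[OF exp_at_bot] filterlim_uminus_at_top[THEN iffD1])
      from tendsto_mult_right_zero[OF this, of "- 1 / l"] show ?thesis by (simp add: mult.commute)
    qed
    show "((\<lambda>t. - exp (- t * l) / l) has_real_derivative exp (- t * l)) (at t)" for t
      using assms by (auto intro!: derivative_eq_intros)
  qed auto
  finally show ?thesis by simp
qed

lemma
  fixes l :: real
  assumes "l > 0"
  shows set_integrable_exp_decay: "set_integrable lborel {0<..} (\<lambda>t. exp (- t * l))"
    and integral_exp_decay: "(LBINT t:{0<..}. exp (- t * l)) = 1 / l"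
proof -
  have "(\<integral>\<^sup>+t. ennreal (indicator {0<..} t *\<^sub>R exp (- t * l)) \<partial>lborel)
      = (\<integral>\<^sup>+t\<in>{0<..}. ennreal (exp (- t * l)) \<partial>lborel)"
    by (intro nn_integral_cong) (auto simp: indicator_def)
  then have "has_bochner_integral lborel (\<lambda>t. indicator {0<..} t *\<^sub>R exp (- t * l)) (1 / l)"
    unfolding nn_integral_exp_decay[OF assms]
    using assms by (intro has_bochner_integral_nn_integral) auto
  then show "set_integrable lborel {0<..} (\<lambda>t. exp (- t * l))" "(LBINT t:{0<..}. exp (- t * l)) = 1 / l"
    by (auto simp: set_integrable_def set_lebesgue_integral_def has_bochner_integral_iff)
qed

text \<open>Termwise integration of \<open>\<Sum> exp(-t l\<^sub>i) c\<^sub>i\<close> over \<open>t > 0\<close>. Fubini's theorem on the product of the counting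
measure and Lebesgue measure applies because \<open>\<Sum> \<integral> exp(-t l\<^sub>i) |c\<^sub>i| dt = \<Sum> |c\<^sub>i| / l\<^sub>i\<close>. For fixed \<open>t\<close> the
inner sum is absolutely convergent since \<open>exp(-t l) \<le> 1/(t l)\<close>.\<close>

lemma laplace_sum:
  fixes c :: "'i \<Rightarrow> complex" and l :: "'i \<Rightarrow> real"
  assumes A: "countable A" and pos: "\<And>i. i \<in> A \<Longrightarrow> l i > 0"
    and summ: "(\<lambda>i. norm (c i) / l i) summable_on A"
  shows "set_integrable lborel {0<..} (\<lambda>t. \<Sum>\<^sub>\<infinity>i\<in>A. of_real (exp (- t * l i)) * c i)"
    and "((\<lambda>i. of_real (inverse (l i)) * c i) has_sum
      (LBINT t:{0<..}. \<Sum>\<^sub>\<infinity>i\<in>A. of_real (exp (- t * l i)) * c i)) A"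
proof -
  interpret C: sigma_finite_measure "count_space A" using A by (rule sigma_finite_measure_count_space_countable)
  interpret P: pair_sigma_finite "count_space A" "lborel :: real measure" ..
  define F where "F i t = indicator {0<..} t *\<^sub>R (of_real (exp (- t * l i)) * c i)" for i t
  have F_meas: "(\<lambda>(i,t). F i t) \<in> borel_measurable (count_space A \<Otimes>\<^sub>M lborel)"
    using A by (rule measurable_pair_measure_countable1) (simp add: F_def)
  have scal: "F i t = (indicator {0<..} t *\<^sub>R exp (- t * l i)) *\<^sub>R c i" for i t
    by (simp add: F_def scaleR_conv_of_real)
  have F_int: "integrable lborel (F i)" "(LINT t|lborel. F i t) = of_real (inverse (l i)) * c i"
    if "i \<in> A" for i
  proof -
    show "integrable lborel (F i)"
      unfolding scal[abs_def] using set_integrable_exp_decay[OF pos[OF that]] by (simp add: set_integrable_def)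
    show "(LINT t|lborel. F i t) = of_real (inverse (l i)) * c i"
      using integral_exp_decay[OF pos[OF that]] set_integrable_exp_decay[OF pos[OF that]]
      unfolding scal set_lebesgue_integral_def set_integrable_def
      by (subst integral_scaleR_left) (auto simp: scaleR_conv_of_real divide_inverse)
  qed
  have norm_int: "(LINT t|lborel. norm (F i t)) = norm (c i) / l i" if "i \<in> A" for i
  proof -
    have "(LINT t|lborel. norm (F i t)) = (LINT t|lborel. (indicator {0<..} t *\<^sub>R exp (- t * l i)) * norm (c i))"
      unfolding scal by (intro Bochner_Integration.integral_cong) (auto simp: indicator_def)
    also have "\<dots> = norm (c i) / l i"
      using integral_exp_decay[OF pos[OF that]] unfolding set_lebesgue_integral_def by simp
    finally show ?thesis .
  qed
  have int: "integrable (count_space A \<Otimes>\<^sub>M lborel) (\<lambda>(i,t). F i t)"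
  proof (rule P.Fubini_integrable[OF F_meas])
    have "Infinite_Set_Sum.abs_summable_on (\<lambda>i. norm (c i) / l i) A"
      using summ pos unfolding abs_summable_equivalent[symmetric]
      by (subst summable_on_cong[of _ _ "\<lambda>i. norm (c i) / l i"]) (auto simp: less_imp_le)
    then have "integrable (count_space A) (\<lambda>i. norm (c i) / l i)"
      by (simp add: Infinite_Set_Sum.abs_summable_on_def)
    then show "integrable (count_space A) (\<lambda>i. LINT t|lborel. norm (case (i, t) of (i, t) \<Rightarrow> F i t))"
      by (rule Bochner_Integration.integrable_cong[THEN iffD1, rotated -1]) (auto simp: norm_int)
    show "AE i in count_space A. integrable lborel (\<lambda>t. case (i, t) of (i, t) \<Rightarrow> F i t)"
      using F_int by (auto simp: AE_count_space)
  qed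
  have sum_t: "(\<lambda>i. norm (of_real (exp (- t * l i)) * c i)) summable_on A" if "t > 0" for t
  proof (rule summable_on_comparison_test)
    show "(\<lambda>i. (1 / t) * (norm (c i) / l i)) summable_on A" using summ by (rule summable_on_cmult_right)
    fix i assume i: "i \<in> A"
    have "t * l i < exp (t * l i)" using exp_ge_add_one_self[of "t * l i"] by linarith
    then have "exp (- (t * l i)) \<le> 1 / (t * l i)"
      using that pos[OF i] by (simp add: exp_minus divide_simps)
    then have "exp (- t * l i) * norm (c i) \<le> 1 / (t * l i) * norm (c i)" by (intro mult_right_mono) auto
    then show "norm (of_real (exp (- t * l i)) * c i) \<le> (1 / t) * (norm (c i) / l i)"
      by (simp add: norm_mult)
  qed auto
  have inner: "(LINT i|count_space A. F i t) = indicator {0<..} t *\<^sub>R (\<Sum>\<^sub>\<infinity>i\<in>A. of_real (exp (- t * l i)) * c i)" for t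
  proof (cases "t > 0")
    case True
    have "Infinite_Set_Sum.abs_summable_on (\<lambda>i. of_real (exp (- t * l i)) * c i) A"
      unfolding abs_summable_equivalent[symmetric] using sum_t[OF True] .
    then show ?thesis using True infsetsum_infsum by (simp add: F_def infsetsum_def flip: infsetsum_infsum)
  qed (simp add: F_def)
  have "integrable lborel (\<lambda>t. LINT i|count_space A. F i t)"
    using P.integrable_snd[OF int] .
  then show "set_integrable lborel {0<..} (\<lambda>t. \<Sum>\<^sub>\<infinity>i\<in>A. of_real (exp (- t * l i)) * c i)"
    unfolding set_integrable_def inner .
  have "(LBINT t:{0<..}. \<Sum>\<^sub>\<infinity>i\<in>A. of_real (exp (- t * l i)) * c i) = (LINT t|lborel. LINT i|count_space A. F i t)"
    unfolding set_lebesgue_integral_def inner ..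
  also have "\<dots> = (LINT i|count_space A. LINT t|lborel. F i t)"
    by (rule P.Fubini_integral[OF int])
  also have "\<dots> = (\<Sum>\<^sub>ai\<in>A. of_real (inverse (l i)) * c i)"
    unfolding infsetsum_def by (intro Bochner_Integration.integral_cong) (auto simp: F_int)
  finally have eq: "(LBINT t:{0<..}. \<Sum>\<^sub>\<infinity>i\<in>A. of_real (exp (- t * l i)) * c i) = \<dots>" .
  have "(\<lambda>i. norm (of_real (inverse (l i)) * c i)) summable_on A"
    using summ by (rule summable_on_cong[THEN iffD1, rotated]) (auto simp: norm_mult norm_inverse divide_inverse pos less_imp_le abs_of_pos)
  then have *: "Infinite_Set_Sum.abs_summable_on (\<lambda>i. of_real (inverse (l i)) * c i) A"
    unfolding abs_summable_equivalent[symmetric] .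
  have "(\<lambda>i. of_real (inverse (l i)) * c i) summable_on A"
    using * unfolding abs_summable_equivalent[symmetric] by (rule abs_summable_summable)
  then show "((\<lambda>i. of_real (inverse (l i)) * c i) has_sum
      (LBINT t:{0<..}. \<Sum>\<^sub>\<infinity>i\<in>A. of_real (exp (- t * l i)) * c i)) A"
    unfolding eq infsetsum_infsum[OF *] by (rule has_sum_infsum)
qed

lemma ennreal_infsum:
  assumes "(g :: 'b \<Rightarrow> real) summable_on A" "\<And>i. i \<in> A \<Longrightarrow> 0 \<le> g i"
  shows "ennreal (\<Sum>\<^sub>\<infinity>i\<in>A. g i) = (\<Sum>\<^sub>\<infinity>i\<in>A. ennreal (g i))"
proof -
  have "ennreal (\<Sum>\<^sub>\<infinity>i\<in>A. g i) = (SUP F\<in>{F. finite F \<and> F \<subseteq> A}. ennreal (sum g F))"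
    by (rule infsum_nonneg_is_SUPREMUM_ennreal[OF assms])
  also have "\<dots> = (SUP F\<in>{F. finite F \<and> F \<subseteq> A}. \<Sum>i\<in>F. ennreal (g i))"
    using assms(2) by (intro SUP_cong refl) (auto simp: sum_ennreal subset_eq)
  also have "\<dots> = (\<Sum>\<^sub>\<infinity>i\<in>A. ennreal (g i))" by (rule nonneg_infsum_complete[symmetric]) auto
  finally show ?thesis .
qed

lemma summable_on_ennreal_finite:
  assumes "(\<Sum>\<^sub>\<infinity>i\<in>A. ennreal (g i)) \<noteq> \<infinity>" "\<And>i. i \<in> A \<Longrightarrow> 0 \<le> g i"
  shows "(g :: 'b \<Rightarrow> real) summable_on A"
proof (rule nonneg_bdd_above_summable_on)
  show "bdd_above (sum g ` {F. F \<subseteq> A \<and> finite F})"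
  proof (rule bdd_aboveI2)
    fix F assume "F \<in> {F. F \<subseteq> A \<and> finite F}"
    then have F: "F \<subseteq> A" "finite F" by auto
    have "ennreal (sum g F) = (\<Sum>i\<in>F. ennreal (g i))" using F assms(2) by (intro sum_ennreal[symmetric]) auto
    also have "\<dots> \<le> (\<Sum>\<^sub>\<infinity>i\<in>A. ennreal (g i))" using F by (subst nonneg_infsum_complete) (auto intro!: SUP_upper)
    also have "\<dots> = ennreal (enn2real (\<Sum>\<^sub>\<infinity>i\<in>A. ennreal (g i)))"
      using assms(1) by (simp add: less_top)
    finally show "sum g F \<le> enn2real (\<Sum>\<^sub>\<infinity>i\<in>A. ennreal (g i))"
      by (simp add: ennreal_le_iff)
  qed
qed (use assms in auto)

section \<open>Fibrewise trace in the Pearson form\<close>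

text \<open>The commutator of \<open>\<sigma>\<^sub>1\<close> with a diagonal matrix is a multiple of a rotation by a right angle, so the
product of its adjoint with another such commutator is a scalar matrix.\<close>

lemma trace_pearson:
  assumes d: "diameter v > 0"
  shows "trace (op_mult (abs_dirac_powr (- of_real s))
          (op_mult (op_adjoint (op_commutator dirac (choice_rep \<tau> f)))
                   (op_commutator dirac (choice_rep \<tau> g))) v)
    = 2 * of_real (diameter v powr (s - 2)) *
       (cnj (f (fst (\<tau> v)) - f (snd (\<tau> v))) * (g (fst (\<tau> v)) - g (snd (\<tau> v))))"
proof -
  have p: "complex_of_real (inverse (diameter v)) powr (- of_real s) = of_real (diameter v powr s)"
  proof -
    have "complex_of_real (inverse (diameter v)) powr (- of_real s) = of_real (inverse (diameter v) powr (- s))"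
      using d powr_of_real[of "inverse (diameter v)" "-s"] by simp
    also have "inverse (diameter v) powr (- s) = diameter v powr s"
      using d by (simp add: powr_minus inverse_powr)
    finally show ?thesis .
  qed
  have q: "diameter v powr (s - 2) = diameter v powr s * (inverse (diameter v) * inverse (diameter v))"
    using d by (simp add: powr_diff power2_eq_square field_simps)
  show ?thesis
    unfolding op_mult_def op_adjoint_def op_commutator_def abs_dirac_powr_def dirac_def p q
    by (simp add: trace_def matrix_matrix_mult_def sum_2 UNIV_2 mat_def conj_transpose_def choice_rep_def sigma1_def
        scaleR_conv_of_real[where 'a = complex] algebra_simps)
qed

section \<open>Compact ultrametric spaces without isolated points\<close>

locale equity_cantor = prob_space \<mu> for \<mu> :: "'a::metric_space measure" +
  assumes sets_mu: "sets \<mu> = sets borel"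
    and compact_UNIV: "compact (UNIV :: 'a set)"
    and perfect: "x islimpt (UNIV :: 'a set)"
    and ultra: "dist x (z::'a) \<le> max (dist x y) (dist y z)"
    and full_support: "measure_support \<mu> = UNIV"
    and equity: "equity_measure \<mu>"
begin

abbreviation V :: "'a set set" where "V \<equiv> michon_vertices"

lemma cball_recenter:
  assumes "y \<in> cball x r" shows "cball y r = cball (x::'a) r"
proof (rule set_eqI)
  fix z
  show "z \<in> cball y r \<longleftrightarrow> z \<in> cball x r"
    using assms ultra[of x z y] ultra[of y z x] by (auto simp: dist_commute)
qed

lemma ball_recenter:
  assumes "y \<in> ball x r" shows "ball y r = ball (x::'a) r"
proof (rule set_eqI)
  fix z
  show "z \<in> ball y r \<longleftrightarrow> z \<in> ball x r"
    using assms ultra[of x z y] ultra[of y z x] by (auto simp: dist_commute)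
qed

lemma closed_ball: "closed (ball (x::'a) r)"
proof -
  have "\<exists>T. open T \<and> y \<in> T \<and> T \<subseteq> - ball x r" if "y \<in> - ball x r" for y
  proof (cases "r > 0")
    case True
    have "z \<notin> ball x r" if "z \<in> ball y r" for z
    proof
      assume "z \<in> ball x r"
      then have "ball y r = ball x r" using ball_recenter that by blast
      then show False using \<open>y \<in> - ball x r\<close> True centre_in_ball by blast
    qed
    then show ?thesis using True by (intro exI[of _ "ball y r"]) auto
  next
    case False
    then show ?thesis by (intro exI[of _ UNIV]) (auto simp: not_less ball_empty)
  qed
  then show ?thesis unfolding closed_def by (subst open_subopen) blast
qed

lemma bounded_set [simp]: "bounded (S :: 'a set)"
  using compact_UNIV bounded_subset compact_imp_bounded by blast

lemma dist_le_diameter: "x \<in> S \<Longrightarrow> y \<in> S \<Longrightarrow> dist x (y::'a) \<le> diameter S"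
  by (rule diameter_bounded_bound) auto

lemma compact_closed: "closed (S :: 'a set) \<Longrightarrow> compact S"
  using compact_UNIV compact_Int_closed[of UNIV S] by simp

lemma diameter_attained:
  assumes "closed (S :: 'a set)" "S \<noteq> {}"
  obtains a b where "a \<in> S" "b \<in> S" "dist a b = diameter S"
  using diameter_compact_attained[OF compact_closed[OF assms(1)] assms(2)] by blast

lemma vertex_closed: "v \<in> V \<Longrightarrow> closed v"
  by (auto simp: michon_vertices_def)

lemma vertex_nonempty: "v \<in> V \<Longrightarrow> v \<noteq> {}"
  by (auto simp: michon_vertices_def)

text \<open>The diameter is attained by compactness, and by the ultrametric inequality it does not exceed the given
radius; so it can serve as the radius, around any point of the ball.\<close>

lemma vertex_eq_cball:
  assumes "v \<in> V" "x \<in> v"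
  shows "v = cball x (diameter v)"
proof -
  obtain z r where v: "v = cball z r" "r > 0" using assms by (auto simp: michon_vertices_def)
  then have vx: "v = cball x r" using assms cball_recenter by blast
  obtain a b where ab: "a \<in> v" "b \<in> v" "dist a b = diameter v"
    using diameter_attained vertex_closed vertex_nonempty assms by metis
  have "dist a b \<le> r" using ab vx ultra[of a b x] by (auto simp: dist_commute)
  then have "cball x (diameter v) \<subseteq> v" using vx ab by auto
  moreover have "v \<subseteq> cball x (diameter v)" using dist_le_diameter[OF assms(2)] by auto
  ultimately show ?thesis by blast
qed

lemma mem_vertex_iff: "v \<in> V \<Longrightarrow> x \<in> v \<Longrightarrow> y \<in> v \<longleftrightarrow> dist x y \<le> diameter v"
  using vertex_eq_cball by (metis mem_cball)

lemma point_near: "r > 0 \<Longrightarrow> \<exists>y. y \<noteq> (x::'a) \<and> dist x y < r"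
  using perfect[of x] by (auto simp: islimpt_approachable dist_commute)

lemma cball_vertex: "r > 0 \<Longrightarrow> cball x r \<in> V"
  by (auto simp: michon_vertices_def)

lemma diameter_pos:
  assumes "v \<in> V" shows "diameter v > 0"
proof -
  obtain z r where v: "v = cball z r" "r > 0" using assms by (auto simp: michon_vertices_def)
  obtain y where "y \<noteq> z" "dist z y < r" using point_near v by blast
  then have "dist z y \<le> diameter v" using v by (auto intro: dist_le_diameter)
  then show ?thesis using \<open>y \<noteq> z\<close> by (smt (verit) zero_less_dist_iff)
qed

lemma vertex_open: "v \<in> V \<Longrightarrow> open v"
proof -
  assume v: "v \<in> V"
  have "\<exists>T. open T \<and> x \<in> T \<and> T \<subseteq> v" if "x \<in> v" for x
  proof (intro exI conjI)
    have "ball x (diameter v) \<subseteq> cball x (diameter v)" by (rule ball_subset_cball)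
    then show "ball x (diameter v) \<subseteq> v" using vertex_eq_cball[OF v that] by simp
  qed (use diameter_pos[OF v] in auto)
  then show ?thesis by (subst open_subopen) blast
qed

lemma UNIV_vertex: "UNIV \<in> V"
proof -
  obtain x :: 'a where True by simp
  have "UNIV = cball x (diameter (UNIV :: 'a set) + 1)"
    using dist_le_diameter[of x UNIV] by (auto simp: add_increasing2)
  moreover have "diameter (UNIV :: 'a set) \<ge> 0" by (rule diameter_ge_0) simp
  ultimately show ?thesis using cball_vertex[of "diameter (UNIV :: 'a set) + 1" x] by simp
qed

lemma vertex_subset_iff:
  assumes "v \<in> V" "w \<in> V" "x \<in> v" "x \<in> w"
  shows "v \<subseteq> w \<longleftrightarrow> diameter v \<le> diameter w" "v \<subset> w \<longleftrightarrow> diameter v < diameter w"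
proof -
  have *: "v \<subseteq> w \<longleftrightarrow> diameter v \<le> diameter w" if "v \<in> V" "w \<in> V" "x \<in> v" "x \<in> w" for v w
  proof
    assume "v \<subseteq> w" then show "diameter v \<le> diameter w" by (intro diameter_subset) auto
  next
    assume "diameter v \<le> diameter w"
    then have "cball x (diameter v) \<subseteq> cball x (diameter w)" by auto
    then show "v \<subseteq> w" using vertex_eq_cball[OF that(1,3)] vertex_eq_cball[OF that(2,4)] by simp
  qed
  show "v \<subseteq> w \<longleftrightarrow> diameter v \<le> diameter w" using * assms by blast
  show "v \<subset> w \<longleftrightarrow> diameter v < diameter w" using *[of v w] *[of w v] assms by auto
qed

lemma finite_ball_cover:
  assumes "r > 0"
  obtains K :: "'a set" where "finite K" "\<And>x. \<exists>k\<in>K. dist k x < r"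
proof -
  obtain K where "finite K" "UNIV \<subseteq> (\<Union>x\<in>K. ball (x::'a) r)"
    using compact_UNIV assms unfolding compact_eq_totally_bounded by blast
  moreover from this have "\<exists>k\<in>K. dist k x < r" for x by fastforce
  ultimately show thesis using that by blast
qed

text \<open>If \<open>K\<close> is an \<open>r\<close>-net and \<open>a, b\<close> are at distance at least \<open>r\<close>, then moving \<open>a\<close> and \<open>b\<close> to nearby points of
\<open>K\<close> does not change their distance. So a vertex of diameter at least \<open>r\<close> is a ball around a point of \<open>K\<close>
whose radius is a distance within \<open>K\<close>.\<close>

lemma finite_large_vertices:
  assumes "r > 0"
  shows "finite {v \<in> V. r \<le> diameter v}"
proof -
  obtain K :: "'a set" where K: "finite K" "\<And>x. \<exists>k\<in>K. dist k x < r"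
    using finite_ball_cover assms by metis
  have "{v \<in> V. r \<le> diameter v} \<subseteq> (\<lambda>(p,q). cball p (dist p q)) ` (K \<times> K)"
  proof
    fix v assume "v \<in> {v \<in> V. r \<le> diameter v}"
    then have v: "v \<in> V" "r \<le> diameter v" by auto
    obtain a b where ab: "a \<in> v" "b \<in> v" "dist a b = diameter v"
      using diameter_attained vertex_closed vertex_nonempty v by metis
    obtain p q where pq: "p \<in> K" "q \<in> K" "dist p a < r" "dist q b < r" using K by metis
    have "dist p q \<le> dist a b" using ultra[of p q a] ultra[of a q b] pq ab v by (auto simp: dist_commute)
    moreover have "dist a b \<le> dist p q"
      using ultra[of a b p] ultra[of p b q] pq ab v by (auto simp: dist_commute)
    ultimately have e: "dist p q = diameter v" using ab by simp
    have "p \<in> v" using mem_vertex_iff[OF v(1) ab(1)] pq v by (auto simp: dist_commute)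
    then have "v = cball p (dist p q)" using vertex_eq_cball v e by metis
    then show "v \<in> (\<lambda>(p,q). cball p (dist p q)) ` (K \<times> K)"
      using pq by (intro image_eqI[of _ _ "(p, q)"]) simp_all
  qed
  then show ?thesis by (rule finite_subset) (use K(1) in simp)
qed

lemma ball_vertex:
  assumes "r > 0" shows "ball (x::'a) r \<in> V" "diameter (ball x r) < r"
proof -
  obtain a b where ab: "a \<in> ball x r" "b \<in> ball x r" "dist a b = diameter (ball x r)"
    using diameter_attained[OF closed_ball, of x r] assms by auto
  then show lt: "diameter (ball x r) < r"
    using ultra[of a b x] by (auto simp: dist_commute)
  obtain y where "y \<noteq> x" "dist x y < r" using point_near assms by blast
  then have "dist x y \<le> diameter (ball x r)" using assms
    by (auto intro: dist_le_diameter)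
  then have "diameter (ball x r) > 0" using \<open>y \<noteq> x\<close> by (smt (verit) zero_less_dist_iff)
  moreover have "ball x r = cball x (diameter (ball x r))"
    using lt assms dist_le_diameter[of x "ball x r"] by auto
  ultimately show "ball x r \<in> V" using cball_vertex by metis
qed

text \<open>The children of \<open>v\<close> are its open balls of radius \<open>diam v\<close>. This description, indexed by points, replaces
the abstract children in everything that follows.\<close>

lemma child_ball:
  assumes "v \<in> V" "x \<in> v"
  shows "ball x (diameter v) \<in> michon_children v"
proof -
  let ?u = "ball x (diameter v)"
  note u = ball_vertex[OF diameter_pos[OF assms(1)], of x]
  have xu: "x \<in> ?u" using diameter_pos assms by auto
  have "w = ?u" if "w \<in> V" "?u \<subseteq> w" "w \<subset> v" for w
  proof -
    have xw: "x \<in> w" using xu that by blast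
    have "diameter w < diameter v" using vertex_subset_iff(2)[OF that(1) assms(1) xw assms(2)] that by blast
    then have "w \<subseteq> ?u" using mem_vertex_iff[OF that(1) xw] by (auto simp: subset_eq)
    then show ?thesis using that by blast
  qed
  moreover have "?u \<subset> v" using vertex_subset_iff(2)[OF u(1) assms(1) xu assms(2)] u by blast
  ultimately show ?thesis using u(1) by (auto simp: michon_children_def)
qed

lemma subset_child_ball:
  assumes "v \<in> V" "w \<in> V" "w \<subset> v" "x \<in> w"
  shows "w \<subseteq> ball x (diameter v)"
proof -
  have "diameter w < diameter v" using vertex_subset_iff(2)[OF assms(2,1,4)] assms by blast
  then show ?thesis using mem_vertex_iff[OF assms(2,4)] by (auto simp: subset_eq)
qed

section \<open>Functions that are constant on small balls\<close>

text \<open>By compactness this is the quantified form of being a test function.\<close>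

definition const_at_scale :: "real \<Rightarrow> ('a \<Rightarrow> complex) \<Rightarrow> bool" where
  "const_at_scale r f \<longleftrightarrow> r > 0 \<and> (\<forall>x y. dist x y < r \<longrightarrow> f x = f y)"

lemma test_functions_iff: "f \<in> test_functions \<longleftrightarrow> (\<exists>r. const_at_scale r f)"
proof
  assume f: "f \<in> test_functions"
  let ?C = "{U. open U \<and> f constant_on U}"
  have "UNIV \<subseteq> \<Union>?C" using f by (fastforce simp: test_functions_def)
  moreover have "?C \<noteq> {}" by (intro notI) (use calculation in auto)
  ultimately obtain r where r: "r > 0" "\<And>T :: 'a set. T \<subseteq> UNIV \<Longrightarrow> diameter T < r \<Longrightarrow> \<exists>B\<in>?C. T \<subseteq> B"
    by - (rule Lebesgue_number_lemma[OF compact_UNIV, of ?C]; auto)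
  have "f x = f y" if "dist x y < r" for x y
  proof -
    obtain B where B: "f constant_on B" "ball x r \<subseteq> B" using r(2)[OF subset_UNIV ball_vertex(2)[OF r(1), of x]] by blast
    have "x \<in> B" "y \<in> B" using B(2) that r(1) by (auto simp: subset_eq)
    then show ?thesis using B(1) by (auto simp: constant_on_def)
  qed
  then show "\<exists>r. const_at_scale r f" using r(1) by (auto simp: const_at_scale_def)
next
  assume "\<exists>r. const_at_scale r f"
  then obtain r where r: "r > 0" "\<And>x y. dist x y < r \<Longrightarrow> f x = f y" by (auto simp: const_at_scale_def)
  have "\<exists>U. open U \<and> x \<in> U \<and> f constant_on U" for x
    by (rule exI[of _ "ball x r"]) (use r in \<open>auto simp: constant_on_def dist_commute\<close>)
  then show "f \<in> test_functions" by (auto simp: test_functions_def)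
qed

lemma const_at_scale_test: "const_at_scale r f \<Longrightarrow> f \<in> test_functions"
  using test_functions_iff by blast

lemma const_at_scale_mono: "const_at_scale r f \<Longrightarrow> 0 < r' \<Longrightarrow> r' \<le> r \<Longrightarrow> const_at_scale r' f"
  by (auto simp: const_at_scale_def)

lemma const_at_scale_combine:
  assumes "const_at_scale r f" "const_at_scale r' g"
  shows "const_at_scale (min r r') (\<lambda>x. h (f x) (g x))"
  unfolding const_at_scale_def
proof (intro conjI allI impI)
  fix x y :: 'a assume "dist x y < min r r'"
  then have "f x = f y" "g x = g y" using assms by (auto simp: const_at_scale_def)
  then show "h (f x) (g x) = h (f y) (g y)" by simp
qed (use assms in \<open>auto simp: const_at_scale_def\<close>)

lemma test_binop: "f \<in> (test_functions :: ('a \<Rightarrow> complex) set) \<Longrightarrow> g \<in> test_functions \<Longrightarrow> (\<lambda>x. h (f x) (g x)) \<in> test_functions"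
  unfolding test_functions_iff using const_at_scale_combine[of _ f _ g h] by blast

lemma test_unop: "f \<in> (test_functions :: ('a \<Rightarrow> complex) set) \<Longrightarrow> (\<lambda>x. h (f x)) \<in> test_functions"
  using test_binop[of f f "\<lambda>a b. h a"] by simp

lemma test_const: "(\<lambda>x::'a. c) \<in> test_functions"
  by (rule const_at_scale_test[of 1]) (simp add: const_at_scale_def)

lemma test_sum: "(\<And>i. i \<in> A \<Longrightarrow> f i \<in> test_functions) \<Longrightarrow> (\<lambda>x::'a. \<Sum>i\<in>A. f i x) \<in> test_functions"
  by (induction A rule: infinite_finite_induct) (auto intro: test_const test_binop)

lemma const_at_scale_indicator: "v \<in> V \<Longrightarrow> const_at_scale (diameter v) (indicator (v :: 'a set))"
  unfolding const_at_scale_def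
proof (intro conjI allI impI)
  fix x y :: 'a assume v: "v \<in> V" and d: "dist x y < diameter v"
  have "x \<in> v \<longleftrightarrow> y \<in> v"
    using mem_vertex_iff[OF v] d by (metis dist_commute less_imp_le)
  then show "indicator v x = (indicator v y :: complex)" by (simp add: indicator_def)
qed (rule diameter_pos)

lemma test_indicator: "v \<in> V \<Longrightarrow> (\<lambda>x. indicator v x :: complex) \<in> test_functions"
  using const_at_scale_indicator const_at_scale_test by blast

section \<open>Test functions as elements of the Hilbert space\<close>

lemma space_mu [simp]: "space \<mu> = UNIV"
  using sets_eq_imp_space_eq[OF sets_mu] by simp

lemma test_bounded:
  fixes f :: "'a \<Rightarrow> complex"
  assumes "f \<in> test_functions"
  obtains B where "\<And>x. norm (f x :: complex) \<le> B" "B \<ge> 0"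
proof -
  obtain r where r: "r > 0" "\<And>x y. dist x y < r \<Longrightarrow> f x = f y"
    using assms[unfolded test_functions_iff] by (auto simp: const_at_scale_def)
  obtain K :: "'a set" where K: "finite K" "\<And>x. \<exists>k\<in>K. dist k x < r" using finite_ball_cover r(1) by metis
  have "norm (f x) \<le> (\<Sum>k\<in>K. norm (f k))" for x
  proof -
    obtain k where "k \<in> K" "f x = f k" using K(2)[of x] r(2) by metis
    then show ?thesis using K(1) by (auto intro: member_le_sum)
  qed
  then show thesis using that sum_nonneg norm_ge_zero by meson
qed

lemma open_measurable: "open A \<Longrightarrow> A \<in> sets \<mu>"
  by (simp add: sets_mu)

lemma vertex_measurable [measurable]: "v \<in> V \<Longrightarrow> v \<in> sets \<mu>"
  by (simp add: open_measurable vertex_open)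

lemma ball_measurable [measurable]: "ball x r \<in> sets \<mu>"
  by (simp add: open_measurable)

lemma test_measurable:
  assumes "f \<in> test_functions" shows "f \<in> borel_measurable \<mu>"
proof -
  obtain r where r: "r > 0" "\<And>x y. dist x y < r \<Longrightarrow> f x = f y"
    using assms[unfolded test_functions_iff] by (auto simp: const_at_scale_def)
  have "continuous_on UNIV f"
    unfolding continuous_on_iff using r by (metis dist_self)
  then have "f \<in> borel_measurable borel" by (rule borel_measurable_continuous_onI)
  then show ?thesis using measurable_cong_sets[OF sets_mu refl] by blast
qed

lemma test_integrable:
  assumes "f \<in> test_functions" shows "integrable \<mu> f"
proof -
  obtain B where "\<And>x. norm (f x) \<le> B" using test_bounded assms by metis
  then show ?thesis using test_measurable[OF assms] by (intro integrable_const_bound[of _ B]) auto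
qed

lemma test_L2:
  assumes "f \<in> test_functions" shows "f \<in> L2_functions \<mu>"
proof -
  have "(\<lambda>x. complex_of_real ((norm (f x))\<^sup>2)) \<in> test_functions" using assms by (rule test_unop)
  then have "integrable \<mu> (\<lambda>x. complex_of_real ((norm (f x))\<^sup>2))" by (rule test_integrable)
  then show ?thesis using test_measurable[OF assms] unfolding complex_of_real_integrable_eq L2_functions_def by blast
qed

lemma open_measure_pos:
  assumes "open A" "A \<noteq> {}" shows "measure \<mu> A > 0"
proof -
  obtain x where "x \<in> A" using assms by blast
  then have "emeasure \<mu> A \<noteq> 0" using full_support assms by (auto simp: measure_support_def)
  then show ?thesis by (simp add: emeasure_eq_measure zero_less_measure_iff)
qed

lemma vertex_measure_pos: "v \<in> V \<Longrightarrow> measure \<mu> v > 0"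
  by (simp add: open_measure_pos vertex_open vertex_nonempty)

section \<open>Masses of vertices and of choice pairs\<close>

text \<open>The common mass of the children; the choice of the point is immaterial by the equity of the measure.\<close>

definition child_mass :: "'a set \<Rightarrow> real" where
  "child_mass v = measure \<mu> (ball (SOME x. x \<in> v) (diameter v))"

lemma measure_child:
  assumes "v \<in> V" "x \<in> v" shows "measure \<mu> (ball x (diameter v)) = child_mass v"
proof -
  have "(SOME x. x \<in> v) \<in> v" using assms(2) by (rule someI)
  then show ?thesis using child_ball assms equity unfolding child_mass_def equity_measure_def by blast
qed

lemma child_subset: "v \<in> V \<Longrightarrow> x \<in> v \<Longrightarrow> ball x (diameter v) \<subseteq> v"
  by (simp add: subset_eq mem_vertex_iff[of v x])

lemma child_mass_bounds:
  assumes "v \<in> V" shows "child_mass v > 0" "2 * child_mass v \<le> measure \<mu> v"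
proof -
  obtain a b where ab: "a \<in> v" "b \<in> v" "dist a b = diameter v"
    using diameter_attained vertex_closed vertex_nonempty assms by metis
  let ?A = "ball a (diameter v)" and ?B = "ball b (diameter v)"
  show "child_mass v > 0"
    using measure_child[OF assms ab(1)] open_measure_pos[of ?A] diameter_pos[OF assms] by auto
  have "?A \<inter> ?B = {}"
  proof (rule equals0I)
    fix y assume "y \<in> ?A \<inter> ?B"
    then show False using ultra[of a b y] ab(3) by (auto simp: dist_commute)
  qed
  then have "measure \<mu> (?A \<union> ?B) = measure \<mu> ?A + measure \<mu> ?B"
    by (intro finite_measure_Union) auto
  moreover have "measure \<mu> (?A \<union> ?B) \<le> measure \<mu> v"
    using child_subset assms ab by (intro finite_measure_mono) auto
  ultimately show "2 * child_mass v \<le> measure \<mu> v" using measure_child assms ab by simp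
qed

abbreviation MM where "MM \<equiv> \<mu> \<Otimes>\<^sub>M \<mu>"

text \<open>The product \<open>\<sigma>\<close>-algebra is generated by rectangles, and by compactness the set is a union of finitely
many squares of balls.\<close>

lemma near_measurable:
  assumes "r > 0" shows "{(x,y). dist x (y::'a) < r} \<in> sets MM"
proof -
  obtain K :: "'a set" where K: "finite K" "\<And>x. \<exists>k\<in>K. dist k x < r" using finite_ball_cover assms by metis
  have "{(x,y). dist x (y::'a) < r} = (\<Union>k\<in>K. ball k r \<times> ball k r)" (is "?A = ?B")
  proof (intro set_eqI iffI)
    fix p assume "p \<in> ?A"
    then obtain x y where p: "p = (x,y)" "dist x y < r" by auto
    obtain k where "k \<in> K" "dist k x < r" using K by blast
    then show "p \<in> ?B" using p ultra[of k y x] by auto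
  next
    fix p assume "p \<in> ?B"
    then obtain k x y where p: "p = (x,y)" "dist k x < r" "dist k y < r" by auto
    then show "p \<in> ?A" using ultra[of x y k] by (auto simp: dist_commute)
  qed
  also have "\<dots> \<in> sets MM" using K by (intro sets.finite_UN) auto
  finally show ?thesis .
qed

lemma choice_pairs_eq:
  "v \<in> V \<Longrightarrow> choice_pairs v = v \<times> v - {(x,y). dist x y < diameter v}"
  by (auto simp: choice_pairs_def) (metis dist_le_diameter nle_le not_less)

lemma choice_pairs_measurable [measurable]: "v \<in> V \<Longrightarrow> choice_pairs v \<in> sets MM"
  using near_measurable[OF diameter_pos, of v] by (simp add: choice_pairs_eq)

interpretation pair: pair_prob_space \<mu> \<mu> ..

text \<open>The slice of \<open>\<Upsilon>\<^sub>v\<close> at \<open>x\<close> is \<open>v\<close> without the child that contains \<open>x\<close>.\<close>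

lemma choice_pairs_section:
  "indicator (choice_pairs v) (x, y) = (indicator v x * (indicator v y - indicator (ball x (diameter v)) y) :: complex)"
  if "v \<in> V"
  using mem_vertex_iff[OF that, of x y] unfolding choice_pairs_eq[OF that] by (auto simp: indicator_def)

text \<open>This is \<open>(\<mu> \<times> \<mu>)(\<Upsilon>\<^sub>v)\<close>, the normalising constant of the factor of \<open>\<nu>\<close> at \<open>v\<close>.\<close>

definition pair_mass :: "'a set \<Rightarrow> real" where
  "pair_mass v = measure \<mu> v * (measure \<mu> v - child_mass v)"

lemma bounded_pair_integrable:
  assumes "F \<in> borel_measurable MM" "\<And>p. norm (F p :: complex) \<le> B"
  shows "integrable MM F"
  using assms by (intro pair.integrable_const_bound[of _ B]) auto

lemma integrable_indicator_complex: "integrable \<mu> (\<lambda>x. indicator v x :: complex)" if "v \<in> sets \<mu>"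
  using that by (intro integrable_const_bound[of _ 1]) (auto simp: indicator_def)

lemma integral_indicator_complex [simp]:
  fixes M :: "'b measure"
  assumes "A \<in> sets M" shows "(LINT x|M. indicator A x :: complex) = of_real (measure M A)"
proof -
  have "(LINT x|M. indicator A x :: complex) = (LINT x|M. complex_of_real (indicator A x))"
    by (intro Bochner_Integration.integral_cong) (auto simp: indicator_def)
  also have "\<dots> = of_real (measure M A)"
    using assms sets.sets_into_space[OF assms] by (simp add: Int_absorb2)
  finally show ?thesis .
qed

lemma measure_choice_pairs:
  assumes v: "v \<in> V" shows "measure MM (choice_pairs v) = pair_mass v"
proof -
  have "complex_of_real (measure MM (choice_pairs v)) = (LINT p|MM. indicator (choice_pairs v) p)"
    using v by simp
  also have "\<dots> = (LINT x|\<mu>. LINT y|\<mu>. indicator (choice_pairs v) (x, y))"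
    using v by (intro pair.integral_fst'[symmetric] bounded_pair_integrable[of _ 1]) (auto simp: indicator_def)
  also have "\<dots> = (LINT x|\<mu>. indicator v x * of_real (measure \<mu> v - child_mass v))"
  proof (intro Bochner_Integration.integral_cong refl)
    fix x
    have "(LINT y|\<mu>. indicator (choice_pairs v) (x, y) :: complex)
       = indicator v x * (LINT y|\<mu>. indicator v y - indicator (ball x (diameter v)) y)"
      by (simp add: choice_pairs_section v)
    also have "\<dots> = indicator v x * (of_real (measure \<mu> v) - of_real (measure \<mu> (ball x (diameter v))))"
      using v by (subst Bochner_Integration.integral_diff) (auto intro: integrable_indicator_complex)
    also have "\<dots> = indicator v x * of_real (measure \<mu> v - child_mass v)"
      using measure_child[OF v] by (auto simp: indicator_def)
    finally show "(LINT y|\<mu>. indicator (choice_pairs v) (x, y) :: complex) = \<dots>" .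
  qed
  also have "\<dots> = of_real (pair_mass v)"
    using v by (simp add: pair_mass_def)
  finally show ?thesis using of_real_eq_iff by blast
qed

lemma pair_mass_pos: "v \<in> V \<Longrightarrow> pair_mass v > 0"
  using child_mass_bounds[of v] vertex_measure_pos[of v] by (simp add: pair_mass_def)

section \<open>The energy of a vertex and its Laplacian\<close>

definition pair_energy :: "'a set \<Rightarrow> ('a \<Rightarrow> complex) \<Rightarrow> ('a \<Rightarrow> complex) \<Rightarrow> complex" where
  "pair_energy v f g = (LINT (x,y)|MM. indicator (choice_pairs v) (x,y) * (cnj (f x - f y) * (g x - g y)))"

text \<open>Written out, this is \<open>2 \<integral> (f x - f y) dy\<close> over the points \<open>y\<close> of \<open>v\<close> outside the child of \<open>x\<close>.\<close>

definition vertex_laplacian :: "'a set \<Rightarrow> ('a \<Rightarrow> complex) \<Rightarrow> 'a \<Rightarrow> complex" where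
  "vertex_laplacian v f x = 2 * indicator v x * (of_real (measure \<mu> v - child_mass v) * f x
     - (LINT y|\<mu>. indicator v y * f y) + (LINT y|\<mu>. indicator (ball x (diameter v)) y * f y))"

lemma indicator_mult_integrable: "A \<in> sets \<mu> \<Longrightarrow> f \<in> test_functions \<Longrightarrow> integrable \<mu> (\<lambda>y. indicator A y * f y)"
proof -
  assume A: "A \<in> sets \<mu>" and f: "f \<in> test_functions"
  have "(\<lambda>y. indicator A y * f y) = (\<lambda>y. indicator A y *\<^sub>R f y)" by (auto simp: indicator_def)
  then show ?thesis using integrable_mult_indicator[OF A test_integrable[OF f]] by simp
qed

text \<open>The integrand \<open>F(x, y) (g x - g y)\<close> splits into two parts, which have equal integrals since \<open>F\<close> is
antisymmetric and \<open>\<Upsilon>\<^sub>v\<close> is symmetric. Integrating out \<open>y\<close> in the first one leaves the operator applied to \<open>f\<close>,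
paired with \<open>g\<close>.\<close>

lemma pair_energy_eq:
  assumes v: "v \<in> V" and f: "f \<in> test_functions" and g: "g \<in> test_functions"
  shows "pair_energy v f g = L2_inner \<mu> (vertex_laplacian v f) g"
proof -
  note [measurable] = test_measurable[OF f] test_measurable[OF g] choice_pairs_measurable[OF v]
  obtain Bf where Bf: "\<And>x. norm (f x) \<le> Bf" "Bf \<ge> 0" using test_bounded f by metis
  obtain Bg where Bg: "\<And>x. norm (g x) \<le> Bg" "Bg \<ge> 0" using test_bounded g by metis
  define F where "F x y = indicator (choice_pairs v) (x,y) * cnj (f x - f y)" for x y
  have F_meas [measurable]: "(\<lambda>(x,y). F x y) \<in> borel_measurable MM"
  proof -
    have [measurable]: "cnj \<in> borel_measurable borel"
      by (intro borel_measurable_continuous_onI continuous_intros)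
    have [measurable]: "indicator (choice_pairs v) \<in> borel_measurable MM" using v by measurable
    show ?thesis unfolding F_def case_prod_beta prod.collapse by measurable
  qed
  have Fb: "norm (F x y) \<le> 2 * Bf" for x y
  proof -
    have "norm (F x y) \<le> norm (f x - f y)" by (auto simp: F_def indicator_def norm_mult simp flip: complex_cnj_diff)
    also have "\<dots> \<le> Bf + Bf" using Bf norm_triangle_ineq4 by (meson add_mono order_trans)
    finally show ?thesis by simp
  qed
  have anti: "F y x = - F x y" for x y
    by (auto simp: F_def indicator_def choice_pairs_def dist_commute)
  have i1: "integrable MM (\<lambda>(x,y). F x y * g x)"
    by (rule bounded_pair_integrable[of _ "2 * Bf * Bg"]) (auto simp: norm_mult intro!: mult_mono Fb Bf Bg)
  have i2: "integrable MM (\<lambda>(x,y). F x y * g y)"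
    by (rule bounded_pair_integrable[of _ "2 * Bf * Bg"]) (auto simp: norm_mult intro!: mult_mono Fb Bf Bg)
  have "pair_energy v f g = (LINT (x,y)|MM. F x y * g x - F x y * g y)"
    unfolding pair_energy_def F_def by (simp add: algebra_simps)
  also have "\<dots> = (LINT (x,y)|MM. F x y * g x) - (LINT (x,y)|MM. F x y * g y)"
    using Bochner_Integration.integral_diff[OF i1 i2] unfolding case_prod_beta .
  also have "(LINT (x,y)|MM. F x y * g y) = (LINT (x,y)|MM. F y x * g x)"
    using pair.integral_product_swap[of "\<lambda>(x,y). F x y * g y"] by (simp add: case_prod_beta)
  also have "\<dots> = - (LINT (x,y)|MM. F x y * g x)"
  proof -
    have "(\<lambda>(x,y). F y x * g x) = (\<lambda>p. - (case p of (x,y) \<Rightarrow> F x y * g x))"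
    proof (rule ext)
      fix p :: "'a \<times> 'a"
      obtain x y where p: "p = (x, y)" by (cases p)
      have "F y x * g x = - (F x y * g x)" using anti[of y x] by simp
      then show "(case p of (x,y) \<Rightarrow> F y x * g x) = - (case p of (x,y) \<Rightarrow> F x y * g x)"
        unfolding p prod.case .
    qed
    then show ?thesis by (simp only: Bochner_Integration.integral_minus)
  qed
  also have "(LINT (x,y)|MM. F x y * g x) = (LINT x|\<mu>. (LINT y|\<mu>. F x y * g x))"
    using pair.integral_fst'[OF i1] by simp
  also have "\<dots> = (LINT x|\<mu>. (LINT y|\<mu>. F x y) * g x)"
    by simp
  finally have *: "pair_energy v f g = (LINT x|\<mu>. 2 * (LINT y|\<mu>. F x y) * g x)" by (simp add: mult.assoc)
  have "2 * (LINT y|\<mu>. F x y) = cnj (vertex_laplacian v f x)" for x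
  proof (cases "x \<in> v")
    case True
    let ?b = "ball x (diameter v)"
    have "cnj (LINT y|\<mu>. F x y) = (LINT y|\<mu>. cnj (F x y))" by simp
    also have "\<dots> = (LINT y|\<mu>. (indicator v y * f x - indicator ?b y * f x) - (indicator v y * f y - indicator ?b y * f y))"
      by (intro Bochner_Integration.integral_cong refl) (use True in \<open>simp only: F_def choice_pairs_section[OF v], simp add: indicator_def algebra_simps\<close>)
    also have "\<dots> = (of_real (measure \<mu> v) * f x - of_real (measure \<mu> ?b) * f x)
        - ((LINT y|\<mu>. indicator v y * f y) - (LINT y|\<mu>. indicator ?b y * f y))"
      using v f by (simp add: Bochner_Integration.integral_diff indicator_mult_integrable integrable_indicator_complex)
    also have "2 * \<dots> = vertex_laplacian v f x"
      using True measure_child[OF v True] by (simp add: vertex_laplacian_def algebra_simps)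
    finally have "2 * cnj (LINT y|\<mu>. F x y) = vertex_laplacian v f x" .
    then show ?thesis by (metis complex_cnj_cnj complex_cnj_mult complex_cnj_numeral)
  next
    case False
    then show ?thesis by (simp add: vertex_laplacian_def F_def choice_pairs_section[OF v])
  qed
  then show ?thesis unfolding * L2_inner_def by simp
qed

lemma pair_energy_sym: "pair_energy v g f = cnj (pair_energy v f g)"
proof -
  have "cnj (pair_energy v f g)
      = (LINT p|MM. cnj (case p of (x, y) \<Rightarrow> indicator (choice_pairs v) (x,y) * (cnj (f x - f y) * (g x - g y))))"
    unfolding pair_energy_def by simp
  also have "\<dots> = pair_energy v g f"
    unfolding pair_energy_def by (intro Bochner_Integration.integral_cong) (auto simp: indicator_def)
  finally show ?thesis by simp
qed

section \<open>The Pearson form as a finite sum of energies\<close>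

definition choice_factor :: "'a set \<Rightarrow> ('a \<times> 'a) measure" where
  "choice_factor v = restrict_space (uniform_measure (\<mu> \<Otimes>\<^sub>M \<mu>) (choice_pairs v)) (choice_pairs v)"

lemma emeasure_choice_pairs: "v \<in> V \<Longrightarrow> emeasure MM (choice_pairs v) = ennreal (pair_mass v)"
proof -
  interpret pair: pair_prob_space \<mu> \<mu> ..
  show "v \<in> V \<Longrightarrow> ?thesis" using measure_choice_pairs by (simp add: pair.emeasure_eq_measure)
qed

lemma prob_choice_factor:
  assumes "v \<in> V" shows "prob_space (choice_factor v)"
proof -
  have "emeasure MM (choice_pairs v) \<noteq> 0" "emeasure MM (choice_pairs v) \<noteq> \<infinity>"
    using emeasure_choice_pairs[OF assms] pair_mass_pos[OF assms] by auto
  then show ?thesis unfolding choice_factor_def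
    using assms by (intro prob_space_restrict_space emeasure_uniform_measure_1) auto
qed

text \<open>On \<open>\<Upsilon>\<^sub>v\<close> the factor of \<open>\<nu>\<close> is the normalised product measure.\<close>

lemma integral_choice_factor:
  fixes G :: "'a \<times> 'a \<Rightarrow> complex"
  assumes "v \<in> V" and [measurable]: "G \<in> borel_measurable MM"
  shows "integral\<^sup>L (choice_factor v) G = (LINT p|MM. indicator (choice_pairs v) p * G p) / of_real (pair_mass v :: real)"
proof -
  note [measurable] = choice_pairs_measurable[OF assms(1)]
  have dens: "indicator A p / ennreal (pair_mass v) = ennreal (indicator A p / pair_mass v)" for A :: "('a\<times>'a) set" and p
    using pair_mass_pos[OF assms(1)] by (auto simp: indicator_def divide_ennreal simp flip: ennreal_1)
  have "integral\<^sup>L (choice_factor v) G =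
      (LINT p|uniform_measure MM (choice_pairs v). indicator (choice_pairs v) p *\<^sub>R G p)"
    unfolding choice_factor_def by (subst integral_restrict_space) auto
  also have "\<dots> = (LINT p|MM. (indicator (choice_pairs v) p / pair_mass v) *\<^sub>R (indicator (choice_pairs v) p *\<^sub>R G p))"
    unfolding uniform_measure_def emeasure_choice_pairs[OF assms(1)] dens
    using pair_mass_pos[OF assms(1)] by (subst integral_density) auto
  also have "\<dots> = (LINT p|MM. (indicator (choice_pairs v) p * G p) / of_real (pair_mass v))"
    by (intro Bochner_Integration.integral_cong) (auto simp: indicator_def scaleR_conv_of_real divide_inverse)
  also have "\<dots> = (LINT p|MM. indicator (choice_pairs v) p * G p) / of_real (pair_mass v)" by simp
  finally show ?thesis .
qed

definition edge_weight :: "real \<Rightarrow> 'a set \<Rightarrow> real" where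
  "edge_weight s v = diameter v powr (s - 2) / pair_mass v"

abbreviation large_vertices :: "real \<Rightarrow> 'a set set" where
  "large_vertices r \<equiv> {v \<in> V. r \<le> diameter v}"

text \<open>If \<open>f\<close> is constant on balls of radius \<open>r\<close>, then for each choice function only vertices of diameter at
least \<open>r\<close> contribute to the trace. The sum is therefore finite and can be exchanged with the integral, and
every summand depends on one coordinate of the choice function only.\<close>

lemma pearson_form_eq:
  assumes f: "const_at_scale r f" and g: "g \<in> test_functions"
  shows "pearson_form \<mu> s f g = (\<Sum>v\<in>large_vertices r. of_real (edge_weight s v) * pair_energy v f g)"
proof -
  have r: "r > 0" using f by (simp add: const_at_scale_def)
  note fin = finite_large_vertices[OF r]
  note tf = const_at_scale_test[OF f]
  define G where "G p = (case p of (x,y) \<Rightarrow> cnj (f x - f y) * (g x - g y))" for p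
  have cnj_meas [measurable]: "cnj \<in> borel_measurable borel"
    by (intro borel_measurable_continuous_onI continuous_intros)
  note [measurable] = test_measurable[OF tf] test_measurable[OF g]
  have G_meas [measurable]: "G \<in> borel_measurable MM"
    unfolding G_def case_prod_beta by measurable
  obtain Bf where Bf: "\<And>x. norm (f x) \<le> Bf" "Bf \<ge> 0" using test_bounded tf by metis
  obtain Bg where Bg: "\<And>x. norm (g x) \<le> Bg" "Bg \<ge> 0" using test_bounded g by metis
  have Gb: "norm (G p) \<le> 4 * (Bf * Bg)" for p
  proof -
    obtain x y where p: "p = (x,y)" by (cases p)
    have "norm (f x - f y) \<le> 2*Bf" "norm (g x - g y) \<le> 2*Bg"
      using norm_triangle_ineq4[of "f x" "f y"] norm_triangle_ineq4[of "g x" "g y"]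
        Bf(1)[of x] Bf(1)[of y] Bg(1)[of x] Bg(1)[of y] by linarith+
    then have "norm (f x - f y) * norm (g x - g y) \<le> (2*Bf) * (2*Bg)"
      using Bf(2) by (intro mult_mono) auto
    then show ?thesis unfolding p G_def by (simp add: norm_mult flip: complex_cnj_diff)
  qed
  have CM: "choice_measure \<mu> = PiM V choice_factor"
    unfolding choice_measure_def choice_factor_def[abs_def] ..
  have meas_factor: "G \<in> borel_measurable (choice_factor v)" if "v \<in> V" for v
    unfolding choice_factor_def by (intro measurable_restrict_space1) (simp add: uniform_measure_def)
  have int_comp: "integrable (PiM V choice_factor) (\<lambda>\<tau>. G (\<tau> v))"
    "(LINT \<tau>|PiM V choice_factor. G (\<tau> v)) = integral\<^sup>L (choice_factor v) G" if v: "v \<in> V" for v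
  proof -
    have D: "distr (PiM V choice_factor) (choice_factor v) (\<lambda>\<tau>. \<tau> v) = choice_factor v"
      by (rule distr_PiM_component) (auto intro: prob_choice_factor v)
    interpret pf: prob_space "choice_factor v" by (rule prob_choice_factor[OF v])
    have m: "(\<lambda>\<tau>. \<tau> v) \<in> measurable (PiM V choice_factor) (choice_factor v)"
      using v by measurable
    have ig: "integrable (choice_factor v) G"
      by (rule pf.integrable_const_bound[of _ "4 * (Bf * Bg)"]) (use Gb meas_factor v in auto)
    show "(LINT \<tau>|PiM V choice_factor. G (\<tau> v)) = integral\<^sup>L (choice_factor v) G"
      using integral_distr[OF m meas_factor[OF v]] D by simp
    show "integrable (PiM V choice_factor) (\<lambda>\<tau>. G (\<tau> v))"
      using integrable_distr[OF m, of G] D ig by simp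
  qed
  have trace_eq: "op_trace (op_mult (abs_dirac_powr (- of_real s))
          (op_mult (op_adjoint (op_commutator dirac (choice_rep \<tau> f)))
                   (op_commutator dirac (choice_rep \<tau> g))))
      = (\<Sum>v\<in>large_vertices r. 2 * of_real (diameter v powr (s - 2)) * G (\<tau> v))"
    if \<tau>: "\<tau> \<in> space (PiM V choice_factor)" for \<tau>
  proof -
    have "op_trace (op_mult (abs_dirac_powr (- of_real s))
          (op_mult (op_adjoint (op_commutator dirac (choice_rep \<tau> f)))
                   (op_commutator dirac (choice_rep \<tau> g))))
      = (\<Sum>\<^sub>\<infinity>v\<in>V. 2 * of_real (diameter v powr (s - 2)) * G (\<tau> v))"
      unfolding op_trace_def
      by (intro infsum_cong) (simp add: trace_pearson diameter_pos G_def case_prod_beta)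
    also have "\<dots> = (\<Sum>\<^sub>\<infinity>v\<in>large_vertices r. 2 * of_real (diameter v powr (s - 2)) * G (\<tau> v))"
    proof (rule infsum_cong_neutral)
      fix v assume "v \<in> V - large_vertices r"
      then have v: "v \<in> V" "diameter v < r" by auto
      have "\<tau> v \<in> space (choice_factor v)" using \<tau> v by (auto simp: space_PiM)
      then have "\<tau> v \<in> choice_pairs v" by (auto simp: choice_factor_def space_restrict_space)
      then have "f (fst (\<tau> v)) = f (snd (\<tau> v))"
        using f v by (auto simp: const_at_scale_def choice_pairs_def)
      then show "2 * of_real (diameter v powr (s - 2)) * G (\<tau> v) = 0" by (simp add: G_def case_prod_beta)
    qed auto
    also have "\<dots> = (\<Sum>v\<in>large_vertices r. 2 * of_real (diameter v powr (s - 2)) * G (\<tau> v))"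
      using fin by (rule infsum_finite)
    finally show ?thesis .
  qed
  have "pearson_form \<mu> s f g = 1/2 * (LINT \<tau>|PiM V choice_factor.
      (\<Sum>v\<in>large_vertices r. 2 * of_real (diameter v powr (s - 2)) * G (\<tau> v)))"
    unfolding pearson_form_def CM using trace_eq by (intro arg_cong2[of _ _ _ _ "(*)"] refl Bochner_Integration.integral_cong)
  also have "(LINT \<tau>|PiM V choice_factor.
      (\<Sum>v\<in>large_vertices r. 2 * of_real (diameter v powr (s - 2)) * G (\<tau> v)))
     = (\<Sum>v\<in>large_vertices r. (LINT \<tau>|PiM V choice_factor. 2 * of_real (diameter v powr (s - 2)) * G (\<tau> v)))"
    by (intro Bochner_Integration.integral_sum integrable_mult_right int_comp) auto
  also have "\<dots> = (\<Sum>v\<in>large_vertices r. 2 * (of_real (edge_weight s v) * pair_energy v f g))"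
  proof (intro sum.cong refl)
    fix v assume "v \<in> large_vertices r"
    then have v: "v \<in> V" by auto
    have "(LINT \<tau>|PiM V choice_factor. 2 * of_real (diameter v powr (s - 2)) * G (\<tau> v))
        = 2 * of_real (diameter v powr (s - 2)) * integral\<^sup>L (choice_factor v) G"
      by (simp add: int_comp(2)[OF v])
    also have "integral\<^sup>L (choice_factor v) G = pair_energy v f g / of_real (pair_mass v)"
      by (simp add: integral_choice_factor[OF v] pair_energy_def G_def case_prod_unfold)
    finally show "(LINT \<tau>|PiM V choice_factor. 2 * of_real (diameter v powr (s - 2)) * G (\<tau> v))
      = 2 * (of_real (edge_weight s v) * pair_energy v f g)" by (simp add: edge_weight_def)
  qed
  finally show ?thesis by (simp add: sum_distrib_left)
qed

text \<open>The operator \<open>-\<Delta>\<^sub>s\<close> on functions that are constant on balls of radius \<open>r\<close>.\<close>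

definition laplacian :: "real \<Rightarrow> real \<Rightarrow> ('a \<Rightarrow> complex) \<Rightarrow> 'a \<Rightarrow> complex" where
  "laplacian s r f x = (\<Sum>v\<in>large_vertices r. of_real (edge_weight s v) * vertex_laplacian v f x)"

lemma const_at_scale_vertex_laplacian:
  assumes "const_at_scale r f" "v \<in> large_vertices r"
  shows "const_at_scale r (vertex_laplacian v f)"
  unfolding const_at_scale_def
proof (intro conjI allI impI)
  show "r > 0" using assms(1) by (simp add: const_at_scale_def)
  fix x y :: 'a assume d: "dist x y < r"
  have v: "v \<in> V" "dist x y < diameter v" using assms d by auto
  have "f x = f y" using assms d by (auto simp: const_at_scale_def)
  moreover have "indicator v x = (indicator v y :: complex)"
    using const_at_scale_indicator[OF v(1)] v(2) unfolding const_at_scale_def by blast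
  moreover have "ball x (diameter v) = ball y (diameter v)"
    using ball_recenter[of y x "diameter v"] v by auto
  ultimately show "vertex_laplacian v f x = vertex_laplacian v f y" by (simp add: vertex_laplacian_def)
qed

lemma const_at_scale_laplacian:
  assumes f: "const_at_scale r f"
  shows "const_at_scale r (laplacian s r f)"
  unfolding const_at_scale_def laplacian_def
  using const_at_scale_vertex_laplacian[OF f] f
  by (auto simp: const_at_scale_def intro!: sum.cong)

lemma test_inner: "f \<in> test_functions \<Longrightarrow> g \<in> test_functions \<Longrightarrow> (\<lambda>x::'a. cnj (f x) * g x) \<in> test_functions"
  by (rule test_binop[where h = "\<lambda>a b. cnj a * b"])

lemma L2_inner_sum:
  assumes "\<And>i. i \<in> A \<Longrightarrow> f i \<in> test_functions" "g \<in> test_functions"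
  shows "L2_inner \<mu> (\<lambda>x. \<Sum>i\<in>A. c i * f i x) g = (\<Sum>i\<in>A. cnj (c i) * L2_inner \<mu> (f i) g)"
proof -
  have "L2_inner \<mu> (\<lambda>x. \<Sum>i\<in>A. c i * f i x) g = (LINT x|\<mu>. (\<Sum>i\<in>A. cnj (c i) * (cnj (f i x) * g x)))"
    unfolding L2_inner_def by (simp add: sum_distrib_right mult.assoc)
  also have "\<dots> = (\<Sum>i\<in>A. (LINT x|\<mu>. cnj (c i) * (cnj (f i x) * g x)))"
    using assms by (intro Bochner_Integration.integral_sum integrable_mult_right test_integrable test_inner)
  finally show ?thesis by (simp add: L2_inner_def)
qed

lemma pearson_form_laplacian:
  assumes f: "const_at_scale r f" and g: "g \<in> test_functions"
  shows "pearson_form \<mu> s f g = L2_inner \<mu> (laplacian s r f) g"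
proof -
  have "L2_inner \<mu> (laplacian s r f) g
      = (\<Sum>v\<in>large_vertices r. cnj (of_real (edge_weight s v)) * L2_inner \<mu> (vertex_laplacian v f) g)"
    unfolding laplacian_def[abs_def]
    by (intro L2_inner_sum g const_at_scale_test[OF const_at_scale_vertex_laplacian[OF f]])
  then show ?thesis
    using pair_energy_eq[OF _ const_at_scale_test[OF f] g]
    by (simp add: pearson_form_eq[OF f g])
qed

lemma pearson_form_sym:
  assumes "f \<in> test_functions" "g \<in> test_functions"
  shows "pearson_form \<mu> s g f = cnj (pearson_form \<mu> s f g)"
proof -
  obtain r where r: "const_at_scale r f" "const_at_scale r g"
  proof -
    obtain r1 r2 where "const_at_scale r1 f" "const_at_scale r2 g" using assms test_functions_iff by blast
    then show thesis using that[of "min r1 r2"] const_at_scale_mono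
      by (auto simp: const_at_scale_def)
  qed
  show ?thesis unfolding pearson_form_eq[OF r(1) assms(2)] pearson_form_eq[OF r(2) assms(1)]
    by (simp add: pair_energy_sym[of _ g f])
qed

text \<open>The chosen representative of \<open>-\<Delta>\<^sub>s f\<close> is only known through its pairings with test functions.\<close>

lemma neg_laplacian_props:
  assumes f: "const_at_scale r f"
  shows "neg_laplacian \<mu> s f \<in> L2_functions \<mu>"
    "g \<in> test_functions \<Longrightarrow> L2_inner \<mu> (neg_laplacian \<mu> s f) g = L2_inner \<mu> (laplacian s r f) g"
proof -
  have "laplacian s r f \<in> L2_functions \<mu> \<and>
    (\<forall>g \<in> test_functions. L2_inner \<mu> (laplacian s r f) g = pearson_form \<mu> s f g)"
    using pearson_form_laplacian[OF f] test_L2[OF const_at_scale_test[OF const_at_scale_laplacian[OF f]]] by auto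
  then have *: "neg_laplacian \<mu> s f \<in> L2_functions \<mu> \<and>
    (\<forall>g \<in> test_functions. L2_inner \<mu> (neg_laplacian \<mu> s f) g = pearson_form \<mu> s f g)"
    unfolding neg_laplacian_def by (rule someI[where x = "laplacian s r f"])
  then show "neg_laplacian \<mu> s f \<in> L2_functions \<mu>"
    "g \<in> test_functions \<Longrightarrow> L2_inner \<mu> (neg_laplacian \<mu> s f) g = L2_inner \<mu> (laplacian s r f) g"
    using pearson_form_laplacian[OF f] by auto
qed

lemma L2_inner_commute: "L2_inner M g f = cnj (L2_inner M f g)"
  unfolding L2_inner_def by (simp add: mult.commute flip: Bochner_Integration.integral_cnj)

lemma eventually_discs:
  "eventually P (discs_shrinking_to z) \<longleftrightarrow> (\<exists>r>0. \<forall>v\<in>V. z \<in> v \<and> diameter v < r \<longrightarrow> P v)"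
  unfolding discs_shrinking_to_def
proof (subst eventually_INF_base)
  fix a b :: real assume "a \<in> {0<..}" "b \<in> {0<..}"
  then show "\<exists>x\<in>{0<..}. principal {v \<in> V. z \<in> v \<and> diameter v < x}
      \<le> inf (principal {v \<in> V. z \<in> v \<and> diameter v < a}) (principal {v \<in> V. z \<in> v \<and> diameter v < b})"
    by (intro bexI[of _ "min a b"]) auto
qed (auto simp: eventually_principal)

text \<open>The averages in the definition are pairings of \<open>-\<Delta>\<^sub>s f\<close> with indicators of discs, so they can be
computed from the locally constant representative, and are equal to its value at \<open>z\<close> as soon as the disc is
small.\<close>

lemma vladimirov_pearson_eq:
  assumes f: "const_at_scale r f"
  shows "vladimirov_pearson \<mu> s f z = laplacian s r f z / 2"
proof -
  have r: "r > 0" using f by (simp add: const_at_scale_def)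
  have ev: "L2_inner \<mu> (indicator v) (neg_laplacian \<mu> s f) / of_real (measure \<mu> v) = laplacian s r f z"
    if v: "v \<in> V" "z \<in> v" "diameter v < r" for v
  proof -
    have "L2_inner \<mu> (indicator v) (neg_laplacian \<mu> s f) = L2_inner \<mu> (indicator v) (laplacian s r f)"
      using neg_laplacian_props(2)[OF f test_indicator[OF v(1)]] L2_inner_commute by metis
    also have "\<dots> = (LINT x|\<mu>. indicator v x * laplacian s r f z)"
      unfolding L2_inner_def
    proof (intro Bochner_Integration.integral_cong refl)
      fix x
      have "laplacian s r f x = laplacian s r f z" if "x \<in> v"
        using const_at_scale_laplacian[OF f, of s] dist_le_diameter[OF that v(2)] v(3)
        unfolding const_at_scale_def by (meson le_less_trans)
      then show "cnj (indicator v x) * laplacian s r f x = indicator v x * laplacian s r f z"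
        by (auto simp: indicator_def)
    qed
    also have "\<dots> = of_real (measure \<mu> v) * laplacian s r f z" using v by simp
    finally show ?thesis using vertex_measure_pos[OF v(1)] by simp
  qed
  have nb: "discs_shrinking_to z \<noteq> bot"
  proof -
    have "\<not> eventually (\<lambda>_. False) (discs_shrinking_to z)"
    proof
      assume "eventually (\<lambda>_. False) (discs_shrinking_to z)"
      then obtain q where q: "q > 0" "\<forall>v\<in>V. z \<in> v \<longrightarrow> \<not> diameter v < q" by (auto simp: eventually_discs)
      then show False using ball_vertex[of q z] by auto
    qed
    then show ?thesis by (metis eventually_bot)
  qed
  have "((\<lambda>v. L2_inner \<mu> (indicator v) (neg_laplacian \<mu> s f) / of_real (measure \<mu> v)) \<longlongrightarrow> laplacian s r f z)
     (discs_shrinking_to z)"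
    by (rule tendsto_eventually) (unfold eventually_discs, use ev r in blast)
  then show ?thesis unfolding vladimirov_pearson_def using tendsto_Lim[OF nb] by simp
qed

section \<open>Branches and Haar functions\<close>

text \<open>The vertices that contain \<open>x\<close>, from the root downwards.\<close>

primrec branch :: "'a \<Rightarrow> nat \<Rightarrow> 'a set" where
  "branch x 0 = UNIV"
| "branch x (Suc n) = ball x (diameter (branch x n))"

lemma branch_vertex: "branch x n \<in> V" and branch_self: "x \<in> branch x n"
proof -
  have "branch x n \<in> V \<and> x \<in> branch x n"
    by (induction n) (auto simp: UNIV_vertex diameter_pos intro: ball_vertex)
  then show "branch x n \<in> V" "x \<in> branch x n" by auto
qed

lemma diameter_branch_less: "diameter (branch x (Suc n)) < diameter (branch x n)"
  using ball_vertex(2)[OF diameter_pos[OF branch_vertex]] by simp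

lemma diameter_branch_strict: "m < n \<Longrightarrow> diameter (branch x n) < diameter (branch x m)"
  by (rule lift_Suc_mono_less[of "\<lambda>n. - diameter (branch x n)", simplified neg_less_iff_less])
    (use diameter_branch_less in auto)

lemma diameter_branch_le: "m \<le> n \<Longrightarrow> diameter (branch x n) \<le> diameter (branch x m)"
  using diameter_branch_strict[of m n x] by (cases "m = n") auto

lemma branch_antimono: "m \<le> n \<Longrightarrow> branch x n \<subseteq> branch x m"
  using vertex_subset_iff(1)[OF branch_vertex branch_vertex branch_self branch_self] diameter_branch_le by blast

lemma inj_branch: "inj (branch x)"
  by (rule linorder_injI) (metis diameter_branch_strict less_irrefl)

text \<open>The diameters decrease strictly, and only finitely many vertices have diameter at least \<open>r\<close>.\<close>

lemma branch_shrinks: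
  assumes "r > 0" obtains N where "\<And>n. N \<le> n \<Longrightarrow> diameter (branch x n) < r"
proof -
  have "\<exists>N. diameter (branch x N) < r"
  proof (rule ccontr)
    assume "\<not> ?thesis"
    then have "range (branch x) \<subseteq> large_vertices r" using branch_vertex by (auto simp: not_less)
    then have "finite (range (branch x))" using finite_large_vertices[OF assms] finite_subset by blast
    then show False using finite_imageD[OF _ inj_branch] by auto
  qed
  then show thesis using that diameter_branch_le by (meson le_less_trans)
qed

lemma ancestors_branch: "{w \<in> V. branch x n \<subset> w} = branch x ` {..<n}"
proof (intro set_eqI iffI)
  fix w assume "w \<in> {w \<in> V. branch x n \<subset> w}"
  then have "w \<in> V" "branch x n \<subset> w" by auto
  then show "w \<in> branch x ` {..<n}"
  proof (induction n)
    case (Suc n)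
    have xw: "x \<in> w" using Suc.prems branch_self[of x "Suc n"] by blast
    have "\<not> w \<subset> branch x n"
      using subset_child_ball[OF branch_vertex[of x n] Suc.prems(1) _ xw] Suc.prems(2) by auto
    then have "branch x n \<subseteq> w"
      using vertex_subset_iff[OF branch_vertex[of x n] Suc.prems(1) branch_self xw]
        vertex_subset_iff[OF Suc.prems(1) branch_vertex[of x n] xw branch_self] by linarith
    then consider "w = branch x n" | "branch x n \<subset> w" by blast
    then show ?case
    proof cases
      case 2
      then show ?thesis using Suc.IH[OF Suc.prems(1)] by auto
    qed simp
  qed auto
next
  fix w assume "w \<in> branch x ` {..<n}"
  then obtain j where j: "j < n" "w = branch x j" by auto
  then show "w \<in> {w \<in> V. branch x n \<subset> w}"
    using branch_vertex vertex_subset_iff(2)[OF branch_vertex branch_vertex branch_self branch_self] diameter_branch_strict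
    by auto
qed

lemma branch_eq: "y \<in> branch x n \<Longrightarrow> branch y n = branch x n"
proof (induction n)
  case (Suc n)
  then have "y \<in> branch x n" using branch_antimono[of n "Suc n" x] by auto
  then show ?case using Suc ball_recenter by simp
qed simp

definition ball_mean :: "'a \<Rightarrow> nat \<Rightarrow> 'a \<Rightarrow> real" where
  "ball_mean x n y = indicator (branch x n) y / measure \<mu> (branch x n)"

text \<open>A martingale difference: the density of the normalised restriction of the measure to a vertex is replaced by
the one for its child containing \<open>x\<close>.\<close>

definition haar :: "'a \<Rightarrow> nat \<Rightarrow> 'a \<Rightarrow> real" where
  "haar x n y = ball_mean x (Suc n) y - ball_mean x n y"

abbreviation haar_c :: "'a \<Rightarrow> nat \<Rightarrow> 'a \<Rightarrow> complex" where
  "haar_c x n \<equiv> (\<lambda>y. of_real (haar x n y))"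

lemma const_at_scale_haar: "const_at_scale (diameter (branch x n)) (haar_c x n)"
  unfolding const_at_scale_def
proof (intro conjI allI impI)
  let ?d = "diameter (branch x n)"
  show "?d > 0" by (simp add: diameter_pos branch_vertex)
  fix y z :: 'a assume d: "dist y z < ?d"
  have "ball y ?d = ball z ?d" using ball_recenter[of z y ?d] d by simp
  moreover have "y \<in> ball y ?d" "z \<in> ball z ?d" using diameter_pos[OF branch_vertex] by auto
  ultimately have "y \<in> ball x ?d \<longleftrightarrow> z \<in> ball x ?d" using ball_recenter by blast
  moreover have "y \<in> branch x n \<longleftrightarrow> z \<in> branch x n"
  proof -
    have "indicator (branch x n) y = (indicator (branch x n) z :: complex)"
      using const_at_scale_indicator[OF branch_vertex[of x n]] d unfolding const_at_scale_def by blast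
    then show ?thesis by (cases "y \<in> branch x n"; cases "z \<in> branch x n") simp_all
  qed
  ultimately show "haar_c x n y = haar_c x n z"
    by (simp add: haar_def ball_mean_def indicator_def)
qed

lemma test_haar: "haar_c x n \<in> test_functions"
  using const_at_scale_haar const_at_scale_test by blast

lemma haar_zero: "y \<notin> branch x n \<Longrightarrow> haar x n y = 0"
  using branch_antimono[of n "Suc n" x] by (auto simp: haar_def ball_mean_def indicator_def)

lemma measure_branch_pos [simp]: "measure \<mu> (branch x n) > 0"
  by (simp add: vertex_measure_pos branch_vertex)

lemma ball_mean_complex:
  "(\<lambda>y. complex_of_real (ball_mean x n y)) = (\<lambda>y. indicator (branch x n) y / of_real (measure \<mu> (branch x n)))"
  by (auto simp: ball_mean_def indicator_def)

lemma test_ball_mean: "(\<lambda>y. complex_of_real (ball_mean x n y)) \<in> test_functions"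
  unfolding ball_mean_complex
  using test_unop[OF test_indicator[OF branch_vertex], of "\<lambda>a. a / of_real (measure \<mu> (branch x n))"] by simp

lemma integral_ball_mean: "(LINT y|\<mu>. complex_of_real (ball_mean x n y)) = 1"
proof -
  have "(LINT y|\<mu>. complex_of_real (ball_mean x n y)) = (LINT y|\<mu>. indicator (branch x n) y) / of_real (measure \<mu> (branch x n))"
    unfolding ball_mean_complex by simp
  also have "\<dots> = 1" using vertex_measurable[OF branch_vertex[of x n]] measure_branch_pos[of x n] by (simp del: measure_branch_pos)
  finally show ?thesis .
qed

lemma integral_haar: "(LINT y|\<mu>. haar_c x n y) = 0"
  unfolding haar_def of_real_diff
  by (subst Bochner_Integration.integral_diff)
    (rule test_integrable test_ball_mean | unfold integral_ball_mean, simp)+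

section \<open>Haar functions are eigenfunctions\<close>

text \<open>The eigenvalue on the functions supported in \<open>v\<close> that are constant on the children of \<open>v\<close> and have
integral zero. Each ancestor \<open>w\<close> contributes through the energy at \<open>w\<close>, where the mass of the other children
of \<open>w\<close> cancels against the normalisation; the last summand is the energy at \<open>v\<close> itself.\<close>

definition haar_eigenvalue :: "real \<Rightarrow> 'a set \<Rightarrow> real" where
  "haar_eigenvalue s v = (\<Sum>w | w \<in> V \<and> v \<subset> w. diameter w powr (s - 2) / measure \<mu> w)
     + diameter v powr (s - 2) / (measure \<mu> v - child_mass v)"

lemma finite_ancestors:
  assumes "v \<in> V" shows "finite {w \<in> V. v \<subset> w}"
proof -
  obtain x where x: "x \<in> v" using vertex_nonempty assms by blast
  have "{w \<in> V. v \<subset> w} \<subseteq> large_vertices (diameter v)"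
    using vertex_subset_iff(2)[OF assms _ x] x by force
  then show ?thesis using finite_large_vertices[OF diameter_pos[OF assms]] finite_subset by blast
qed

lemma vertex_laplacian_haar_disjoint:
  assumes w: "w \<in> V" "w \<inter> branch x n = {}"
  shows "vertex_laplacian w (haar_c x n) z = 0"
proof (cases "z \<in> w")
  case True
  have "y \<in> w \<Longrightarrow> haar x n y = 0" for y using w(2) haar_zero[of y] by blast
  then have "(\<lambda>y. indicator w y * haar_c x n y) = (\<lambda>_. 0)" "haar x n z = 0"
    "(\<lambda>y. indicator (ball z (diameter w)) y * haar_c x n y) = (\<lambda>_. 0)"
    using True child_subset[OF w(1) True] by (auto simp: indicator_def fun_eq_iff subset_eq)
  then show ?thesis unfolding vertex_laplacian_def by simp
qed (simp add: vertex_laplacian_def)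

lemma integral_indicator_haar:
  assumes "branch x n \<subseteq> A \<or> branch x n \<inter> A = {}"
  shows "(LINT y|\<mu>. indicator A y * haar_c x n y) = 0"
  using assms
proof
  assume "branch x n \<subseteq> A"
  then have "(\<lambda>y. indicator A y * haar_c x n y) = haar_c x n"
    using haar_zero by (fastforce simp: indicator_def)
  then show ?thesis by (simp only: integral_haar)
next
  assume "branch x n \<inter> A = {}"
  then have "(\<lambda>y. indicator A y * haar_c x n y) = (\<lambda>_. 0)"
    using haar_zero by (fastforce simp: indicator_def)
  then show ?thesis by simp
qed

text \<open>The integral over \<open>v\<close> vanishes, and the integral over the child containing \<open>z\<close> is its mass times the value
at \<open>z\<close>; this compensates the missing mass in the first summand.\<close>

lemma vertex_laplacian_haar_self:
  "vertex_laplacian (branch x n) (haar_c x n) z = 2 * of_real (measure \<mu> (branch x n)) * haar_c x n z"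
proof (cases "z \<in> branch x n")
  case True
  let ?b = "ball z (diameter (branch x n))"
  have "(LINT y|\<mu>. indicator ?b y * haar_c x n y) = (LINT y|\<mu>. indicator ?b y * haar_c x n z)"
    using const_at_scale_haar[of x n] unfolding const_at_scale_def
    by (intro Bochner_Integration.integral_cong) (auto simp: indicator_def dist_commute)
  also have "\<dots> = of_real (child_mass (branch x n)) * haar_c x n z"
    using measure_child[OF branch_vertex True] by simp
  finally show ?thesis using True integral_indicator_haar[of x n "branch x n"]
    by (simp add: vertex_laplacian_def algebra_simps)
qed (simp add: vertex_laplacian_def haar_zero)

text \<open>The children of a larger vertex either contain the support of the Haar function or do not meet it, so both
integrals vanish.\<close>

lemma vertex_laplacian_haar_above:
  assumes w: "w \<in> V" "branch x n \<subset> w"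
  shows "vertex_laplacian w (haar_c x n) z = 2 * of_real (measure \<mu> w - child_mass w) * haar_c x n z"
proof (cases "z \<in> w")
  case True
  let ?b = "ball z (diameter w)"
  have "branch x n \<subseteq> ?b \<or> branch x n \<inter> ?b = {}"
  proof (cases "branch x n \<inter> ?b = {}")
    case False
    then obtain y where y: "y \<in> branch x n" "y \<in> ?b" by blast
    then show ?thesis using subset_child_ball[OF w(1) branch_vertex w(2) y(1)] ball_recenter[OF y(2)] by simp
  qed simp
  then have "(LINT y|\<mu>. indicator ?b y * haar_c x n y) = 0" by (rule integral_indicator_haar)
  moreover have "(LINT y|\<mu>. indicator w y * haar_c x n y) = 0" using w by (intro integral_indicator_haar) auto
  ultimately show ?thesis using True by (simp add: vertex_laplacian_def)
next
  case False
  then show ?thesis using w haar_zero[of z x n] by (auto simp: vertex_laplacian_def)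
qed

text \<open>A vertex that is at least as large as \<open>b\<^sub>n\<close> either is disjoint from it, or equal to it, or one of its
ancestors. The smaller vertices do not occur, since the Haar function is constant on balls of radius
\<open>diam b\<^sub>n\<close>.\<close>

lemma laplacian_haar:
  "laplacian s (diameter (branch x n)) (haar_c x n) z = 2 * of_real (haar_eigenvalue s (branch x n)) * haar_c x n z"
proof -
  let ?v = "branch x n" and ?h = "haar_c x n" and ?A = "{w \<in> V. branch x n \<subset> w}"
  have vV: "?v \<in> V" by (rule branch_vertex)
  have sub: "insert ?v ?A \<subseteq> large_vertices (diameter ?v)"
    using vertex_subset_iff(2)[OF vV _ branch_self] branch_self[of x n] vV by force
  have "laplacian s (diameter ?v) ?h z = (\<Sum>w\<in>insert ?v ?A. of_real (edge_weight s w) * vertex_laplacian w ?h z)"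
    unfolding laplacian_def
  proof (intro sum.mono_neutral_right finite_large_vertices diameter_pos vV sub ballI)
    fix w assume "w \<in> large_vertices (diameter ?v) - insert ?v ?A"
    then have w: "w \<in> V" "diameter ?v \<le> diameter w" "\<not> ?v \<subseteq> w" by auto
    then have "w \<inter> ?v = {}" using vertex_subset_iff(1)[OF vV w(1)] by blast
    then show "of_real (edge_weight s w) * vertex_laplacian w ?h z = 0"
      using vertex_laplacian_haar_disjoint[OF w(1)] by simp
  qed
  also have "\<dots> = of_real (edge_weight s ?v) * vertex_laplacian ?v ?h z
     + (\<Sum>w\<in>?A. of_real (edge_weight s w) * vertex_laplacian w ?h z)"
    using finite_ancestors[OF vV] by simp
  also have "of_real (edge_weight s ?v) * vertex_laplacian ?v ?h z
     = 2 * of_real (diameter ?v powr (s - 2) / (measure \<mu> ?v - child_mass ?v)) * ?h z"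
    using child_mass_bounds[OF vV] measure_branch_pos[of x n]
    by (simp add: vertex_laplacian_haar_self edge_weight_def pair_mass_def field_simps)
  also have "(\<Sum>w\<in>?A. of_real (edge_weight s w) * vertex_laplacian w ?h z)
     = (\<Sum>w\<in>?A. of_real (diameter w powr (s - 2) / measure \<mu> w) * (2 * ?h z))"
  proof (intro sum.cong refl)
    fix w assume "w \<in> ?A"
    then have w: "w \<in> V" "?v \<subset> w" by auto
    have "edge_weight s w * (measure \<mu> w - child_mass w) = diameter w powr (s - 2) / measure \<mu> w"
      using child_mass_bounds[OF w(1)] vertex_measure_pos[OF w(1)] by (simp add: edge_weight_def pair_mass_def)
    then have "complex_of_real (edge_weight s w) * of_real (measure \<mu> w - child_mass w)
        = of_real (diameter w powr (s - 2) / measure \<mu> w)"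
      by (metis of_real_mult)
    then show "of_real (edge_weight s w) * vertex_laplacian w ?h z =
       of_real (diameter w powr (s - 2) / measure \<mu> w) * (2 * ?h z)"
      unfolding vertex_laplacian_haar_above[OF w] by (metis (no_types, lifting) mult.assoc mult.left_commute)
  qed
  also have "\<dots> = (\<Sum>w\<in>?A. of_real (diameter w powr (s - 2) / measure \<mu> w)) * (2 * ?h z)"
    by (rule sum_distrib_right[symmetric])
  finally show ?thesis unfolding haar_eigenvalue_def of_real_add of_real_sum by (simp only: algebra_simps)
qed

lemma vladimirov_pearson_haar:
  "vladimirov_pearson \<mu> s (haar_c x n) z = of_real (haar_eigenvalue s (branch x n)) * haar_c x n z"
  by (simp add: vladimirov_pearson_eq[OF const_at_scale_haar] laplacian_haar)

lemma vladimirov_pearson_one: "vladimirov_pearson \<mu> s (\<lambda>_. 1) z = 0"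
proof -
  have c: "const_at_scale 1 (\<lambda>_::'a. 1)" by (simp add: const_at_scale_def)
  have "vertex_laplacian v (\<lambda>_. 1) z = 0" if "v \<in> V" for v
    using measure_child[OF that, of z] that by (cases "z \<in> v") (simp_all add: vertex_laplacian_def)
  then show ?thesis unfolding vladimirov_pearson_eq[OF c] laplacian_def by simp
qed

lemma test_vladimirov_pearson:
  assumes "f \<in> test_functions" shows "vladimirov_pearson \<mu> s f \<in> test_functions"
proof -
  obtain r where r: "const_at_scale r f" using assms test_functions_iff by blast
  have "vladimirov_pearson \<mu> s f = (\<lambda>z. laplacian s r f z / 2)"
    using vladimirov_pearson_eq[OF r] by blast
  then show ?thesis using test_unop[OF const_at_scale_test[OF const_at_scale_laplacian[OF r]], of "\<lambda>a. a / 2"] by simp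
qed

lemma vladimirov_pearson_form:
  assumes "f \<in> test_functions" "g \<in> test_functions"
  shows "L2_inner \<mu> (vladimirov_pearson \<mu> s f) g = pearson_form \<mu> s f g / 2"
proof -
  obtain r where r: "const_at_scale r f" using assms test_functions_iff by blast
  show ?thesis unfolding pearson_form_laplacian[OF r assms(2)] L2_inner_def vladimirov_pearson_eq[OF r]
    by simp
qed

lemma vladimirov_pearson_symmetric:
  assumes "f \<in> test_functions" "g \<in> test_functions"
  shows "L2_inner \<mu> (vladimirov_pearson \<mu> s f) g = L2_inner \<mu> f (vladimirov_pearson \<mu> s g)"
proof -
  have "L2_inner \<mu> f (vladimirov_pearson \<mu> s g) = cnj (pearson_form \<mu> s g f / 2)"
    using vladimirov_pearson_form[OF assms(2,1)] L2_inner_commute by metis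
  also have "\<dots> = pearson_form \<mu> s f g / 2" using pearson_form_sym[OF assms, of s] by simp
  finally show ?thesis using vladimirov_pearson_form[OF assms, of s] by metis
qed

section \<open>Weak eigenvalue equation for the closure\<close>

lemma L2_diff:
  assumes "f \<in> L2_functions \<mu>" "g \<in> L2_functions \<mu>"
  shows "integrable \<mu> (\<lambda>x. (norm (f x - g x))\<^sup>2)"
proof (rule Bochner_Integration.integrable_bound)
  have [measurable]: "f \<in> borel_measurable \<mu>" "g \<in> borel_measurable \<mu>" using assms by (auto simp: L2_functions_def)
  show "integrable \<mu> (\<lambda>x. 2 * (norm (f x))\<^sup>2 + 2 * (norm (g x))\<^sup>2)" using assms by (auto simp: L2_functions_def)
  show "(\<lambda>x. (norm (f x - g x))\<^sup>2) \<in> borel_measurable \<mu>" by measurable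
  have "(norm (f x - g x))\<^sup>2 \<le> 2 * (norm (f x))\<^sup>2 + 2 * (norm (g x))\<^sup>2" for x
  proof -
    have "(norm (f x - g x))\<^sup>2 \<le> (norm (f x) + norm (g x))\<^sup>2"
      using norm_triangle_ineq4[of "f x" "g x"] by (intro power_mono) auto
    also have "\<dots> \<le> 2 * (norm (f x))\<^sup>2 + 2 * (norm (g x))\<^sup>2"
      using sum_squares_bound[of "norm (f x)" "norm (g x)"] by (simp add: power2_sum)
    finally show ?thesis .
  qed
  then show "AE x in \<mu>. norm ((norm (f x - g x))\<^sup>2) \<le> norm (2 * (norm (f x))\<^sup>2 + 2 * (norm (g x))\<^sup>2)" by auto
qed

lemma L2_integrable:
  assumes "f \<in> L2_functions \<mu>" shows "integrable \<mu> f"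
proof (rule Bochner_Integration.integrable_bound)
  show "integrable \<mu> (\<lambda>x. 1 + (norm (f x))\<^sup>2)" using assms by (auto simp: L2_functions_def)
  show "f \<in> borel_measurable \<mu>" using assms by (auto simp: L2_functions_def)
  have "norm (f x) \<le> 1 + (norm (f x))\<^sup>2" for x
    using sum_squares_bound[of "norm (f x)" 1] by (simp add: power2_eq_square) (smt (verit) norm_ge_zero)
  then show "AE x in \<mu>. norm (f x) \<le> norm (1 + (norm (f x))\<^sup>2)" by auto
qed

text \<open>The norm in \<open>L\<^sup>1\<close> is at most the norm in \<open>L\<^sup>2\<close> because the variance of \<open>|F\<^sub>n - f|\<close> is nonnegative.\<close>

lemma L2_inner_tendsto:
  assumes F: "\<And>n. F n \<in> L2_functions \<mu>" and f: "f \<in> L2_functions \<mu>" and h: "h \<in> test_functions"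
    and lim: "(\<lambda>n. L2_sqdist \<mu> (F n) f) \<longlonglongrightarrow> 0"
  shows "(\<lambda>n. L2_inner \<mu> (F n) h) \<longlonglongrightarrow> L2_inner \<mu> f h"
proof -
  obtain B where B: "\<And>x. norm (h x) \<le> B" "B \<ge> 0" using test_bounded h by metis
  define q where "q n = (LINT x|\<mu>. (norm (F n x - f x))\<^sup>2)" for n
  have "L2_sqdist \<mu> (F n) f = ennreal (q n)" for n
    unfolding L2_sqdist_def q_def by (intro nn_integral_eq_integral L2_diff F f) auto
  then have "q \<longlonglongrightarrow> 0" using lim by (simp add: ennreal_tendsto_0_iff q_def[abs_def])
  then have q0: "(\<lambda>n. B * sqrt (q n)) \<longlonglongrightarrow> 0"
    using tendsto_mult_right_zero[OF tendsto_real_sqrt[of q 0 sequentially, simplified]] by simp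
  note [measurable] = test_measurable[OF h]
  have mult_int: "integrable \<mu> (\<lambda>x. cnj (k x) * h x)" if k: "integrable \<mu> k" for k :: "'a \<Rightarrow> complex"
  proof (rule Bochner_Integration.integrable_bound)
    show "integrable \<mu> (\<lambda>x. B * norm (k x))" using k by simp
    show "(\<lambda>x. cnj (k x) * h x) \<in> borel_measurable \<mu>"
      using borel_measurable_integrable[OF integrable_cnj[OF k]] by measurable
    show "AE x in \<mu>. norm (cnj (k x) * h x) \<le> norm (B * norm (k x))"
      using B by (auto simp: norm_mult mult.commute intro!: mult_right_mono)
  qed
  have "norm (L2_inner \<mu> (F n) h - L2_inner \<mu> f h) \<le> B * sqrt (q n)" for n
  proof -
    define d where "d x = F n x - f x" for x
    have d: "integrable \<mu> d" "integrable \<mu> (\<lambda>x. (norm (d x))\<^sup>2)"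
      using L2_integrable[OF F] L2_integrable[OF f] L2_diff[OF F f] by (auto simp: d_def[abs_def])
    have "L2_inner \<mu> (F n) h - L2_inner \<mu> f h = (LINT x|\<mu>. cnj (d x) * h x)"
      unfolding L2_inner_def d_def using mult_int[OF L2_integrable[OF F]] mult_int[OF L2_integrable[OF f]]
      by (subst Bochner_Integration.integral_diff[symmetric]) (auto simp: algebra_simps)
    also have "norm \<dots> \<le> (LINT x|\<mu>. norm (cnj (d x) * h x))" by (rule integral_norm_bound)
    also have "\<dots> \<le> (LINT x|\<mu>. B * norm (d x))"
    proof (rule integral_mono)
      show "integrable \<mu> (\<lambda>x. norm (cnj (d x) * h x))" by (rule integrable_norm[OF mult_int[OF d(1)]])
      show "norm (cnj (d x) * h x) \<le> B * norm (d x)" for x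
        using mult_right_mono[OF B(1), of "norm (d x)"] by (simp add: norm_mult mult.commute)
    qed (use integrable_norm[OF d(1)] in simp)
    also have "\<dots> = B * (LINT x|\<mu>. norm (d x))" by simp
    also have "(LINT x|\<mu>. norm (d x)) \<le> sqrt (q n)"
    proof (rule real_le_rsqrt)
      have "0 \<le> variance (\<lambda>x. norm (d x))" by (rule variance_positive)
      also have "\<dots> = q n - (LINT x|\<mu>. norm (d x))\<^sup>2"
        using integrable_norm[OF d(1)] d(2) by (subst variance_eq) (simp_all add: q_def d_def)
      finally show "(LINT x|\<mu>. norm (d x))\<^sup>2 \<le> q n" by simp
    qed
    finally show ?thesis using B by (simp add: mult_left_mono)
  qed
  then have "(\<lambda>n. L2_inner \<mu> (F n) h - L2_inner \<mu> f h) \<longlonglongrightarrow> 0"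
    by (intro Lim_null_comparison[OF _ q0] always_eventually) auto
  then show ?thesis by (simp add: LIM_zero_iff)
qed

text \<open>Symmetry moves the operator to \<open>h\<close> along an approximating sequence of test functions, so that only
\<open>L\<^sup>2\<close>-convergence is needed to pass to the limit. For a pair \<open>(\<phi>, \<lambda>\<phi>)\<close> in the closure this shows that \<open>\<phi>\<close>
is orthogonal to \<open>h\<close> unless \<open>\<lambda> = l\<close>.\<close>

lemma closure_weak_eigen:
  assumes cl: "(f, g) \<in> vladimirov_pearson_closure \<mu> s"
    and h: "h \<in> test_functions" "\<And>z. vladimirov_pearson \<mu> s h z = of_real l * h z"
  shows "L2_inner \<mu> g h = of_real l * L2_inner \<mu> f h"
proof -
  obtain F where F: "\<And>n. F n \<in> test_functions" "(\<lambda>n. L2_sqdist \<mu> (F n) f) \<longlonglongrightarrow> 0"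
    "(\<lambda>n. L2_sqdist \<mu> (vladimirov_pearson \<mu> s (F n)) g) \<longlonglongrightarrow> 0"
    and fg: "f \<in> L2_functions \<mu>" "g \<in> L2_functions \<mu>"
    using cl by (auto simp: vladimirov_pearson_closure_def)
  have "(\<lambda>n. L2_inner \<mu> (vladimirov_pearson \<mu> s (F n)) h) \<longlonglongrightarrow> L2_inner \<mu> g h"
    by (rule L2_inner_tendsto) (auto intro: test_L2 test_vladimirov_pearson F h fg)
  moreover have "L2_inner \<mu> (vladimirov_pearson \<mu> s (F n)) h = of_real l * L2_inner \<mu> (F n) h" for n
  proof -
    have "L2_inner \<mu> (vladimirov_pearson \<mu> s (F n)) h = L2_inner \<mu> (F n) (\<lambda>z. of_real l * h z)"
      unfolding vladimirov_pearson_symmetric[OF F(1) h(1)] using h(2) by presburger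
    also have "\<dots> = of_real l * L2_inner \<mu> (F n) h" by (simp add: L2_inner_def mult.left_commute)
    finally show ?thesis .
  qed
  moreover have "(\<lambda>n. of_real l * L2_inner \<mu> (F n) h) \<longlonglongrightarrow> of_real l * L2_inner \<mu> f h"
    by (intro tendsto_mult_left L2_inner_tendsto) (auto intro: test_L2 F h fg)
  ultimately show ?thesis using LIMSEQ_unique by simp
qed

section \<open>Expansion of a test function along a branch\<close>

lemma L2_inner_sum_right:
  assumes "\<And>i. i \<in> A \<Longrightarrow> f i \<in> test_functions" "g \<in> test_functions"
  shows "L2_inner \<mu> g (\<lambda>x. \<Sum>i\<in>A. c i * f i x) = (\<Sum>i\<in>A. c i * L2_inner \<mu> g (f i))"
proof -
  have "L2_inner \<mu> g (\<lambda>x. \<Sum>i\<in>A. c i * f i x) = cnj (L2_inner \<mu> (\<lambda>x. \<Sum>i\<in>A. c i * f i x) g)"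
    by (rule L2_inner_commute)
  also have "\<dots> = cnj (\<Sum>i\<in>A. cnj (c i) * L2_inner \<mu> (f i) g)"
    using L2_inner_sum[of A f g c] assms by simp
  also have "\<dots> = (\<Sum>i\<in>A. c i * cnj (L2_inner \<mu> (f i) g))" by simp
  also have "\<dots> = (\<Sum>i\<in>A. c i * L2_inner \<mu> g (f i))"
    by (simp only: L2_inner_commute[of \<mu> g])
  finally show ?thesis .
qed

lemma L2_inner_diff_right:
  assumes "f \<in> test_functions" "g \<in> test_functions" "h \<in> test_functions"
  shows "L2_inner \<mu> h (\<lambda>x. f x - g x) = L2_inner \<mu> h f - L2_inner \<mu> h g"
  unfolding L2_inner_def right_diff_distrib
  by (intro Bochner_Integration.integral_diff test_integrable test_inner assms)

text \<open>The support of the measure is the whole space, so a test function that vanishes almost everywhere vanishes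
everywhere. This turns identities in \<open>L\<^sup>2\<close> into pointwise ones.\<close>

lemma test_zero:
  assumes f: "f \<in> test_functions" and z: "(LINT x|\<mu>. (norm (f x))\<^sup>2) \<le> 0"
  shows "f x = 0"
proof (rule ccontr)
  assume "f x \<noteq> 0"
  obtain r where r: "r > 0" "\<And>x y. dist x y < r \<Longrightarrow> f x = f y"
    using f[unfolded test_functions_iff] by (auto simp: const_at_scale_def)
  have "0 < measure \<mu> (ball x r) * (norm (f x))\<^sup>2"
    using \<open>f x \<noteq> 0\<close> r open_measure_pos[of "ball x r"] by simp
  also have "\<dots> = (LINT y|\<mu>. indicator (ball x r) y * (norm (f x))\<^sup>2)" by simp
  also have "\<dots> \<le> (LINT y|\<mu>. (norm (f y))\<^sup>2)"
  proof (rule integral_mono)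
    show "integrable \<mu> (\<lambda>y. (norm (f y))\<^sup>2)" using test_L2[OF f] by (simp add: L2_functions_def)
    show "indicator (ball x r) y * (norm (f x))\<^sup>2 \<le> (norm (f y))\<^sup>2" for y
      using r(2)[of x y] by (auto simp: indicator_def)
    show "integrable \<mu> (\<lambda>y. indicator (ball x r) y * (norm (f x))\<^sup>2)"
      by (intro integrable_mult_left integrable_real_indicator) (auto simp: less_top[symmetric])
  qed
  finally show False using z by simp
qed

lemma haar_telescope: "(\<Sum>k<n. haar x k y) = ball_mean x n y - 1"
proof -
  have "ball_mean x 0 y = 1" by (simp add: ball_mean_def prob_space[unfolded space_mu])
  then show ?thesis unfolding haar_def using sum_lessThan_telescope[of "\<lambda>k. ball_mean x k y" n] by simp
qed

lemma ball_mean_inner: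
  assumes f: "const_at_scale r f" and n: "diameter (branch x n) < r"
  shows "L2_inner \<mu> f (\<lambda>y. of_real (ball_mean x n y)) = cnj (f x)"
proof -
  have "L2_inner \<mu> f (\<lambda>y. of_real (ball_mean x n y)) = (LINT y|\<mu>. cnj (f x) * of_real (ball_mean x n y))"
    unfolding L2_inner_def
  proof (intro Bochner_Integration.integral_cong refl)
    fix y
    have "f y = f x" if "y \<in> branch x n"
      using f dist_le_diameter[OF that branch_self] n unfolding const_at_scale_def by (meson le_less_trans)
    then show "cnj (f y) * of_real (ball_mean x n y) = cnj (f x) * of_real (ball_mean x n y)"
      by (auto simp: ball_mean_def indicator_def)
  qed
  also have "\<dots> = cnj (f x) * (LINT y|\<mu>. of_real (ball_mean x n y))"
    by (rule integral_mult_right_zero)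
  finally show ?thesis by (simp only: integral_ball_mean mult_1_right)
qed

text \<open>On a small enough ball of the branch \<open>f\<close> is constant, so its value at \<open>x\<close> is its mean over that ball, and the
mean is a telescoping sum of pairings with Haar functions.\<close>

lemma haar_expansion:
  assumes f: "const_at_scale r f" and n: "diameter (branch x n) < r"
  shows "cnj (f x) = L2_inner \<mu> f (\<lambda>_. 1) + (\<Sum>k<n. L2_inner \<mu> f (haar_c x k))"
proof -
  have tf: "f \<in> test_functions" using const_at_scale_test[OF f] .
  have "(\<Sum>k<n. L2_inner \<mu> f (haar_c x k)) = (\<Sum>k<n. 1 * L2_inner \<mu> f (haar_c x k))" by simp
  also have "\<dots> = L2_inner \<mu> f (\<lambda>y. \<Sum>k<n. 1 * haar_c x k y)"
    by (rule L2_inner_sum_right[symmetric]) (auto intro: test_haar tf)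
  also have "(\<lambda>y. \<Sum>k<n. 1 * haar_c x k y) = (\<lambda>y. of_real (ball_mean x n y) - 1)"
    using haar_telescope[where x = x and n = n] by (simp flip: of_real_sum)
  also have "L2_inner \<mu> f \<dots> = L2_inner \<mu> f (\<lambda>y. of_real (ball_mean x n y)) - L2_inner \<mu> f (\<lambda>_. 1)"
    by (intro L2_inner_diff_right test_ball_mean test_const tf)
  finally show ?thesis using ball_mean_inner[OF f n] by simp
qed

section \<open>Masses and eigenvalues along a branch\<close>

lemma measure_branch_Suc: "measure \<mu> (branch x (Suc k)) = child_mass (branch x k)"
  using measure_child[OF branch_vertex branch_self] by simp

lemma measure_branch_half: "2 * measure \<mu> (branch x (Suc k)) \<le> measure \<mu> (branch x k)"
  unfolding measure_branch_Suc by (rule child_mass_bounds(2)[OF branch_vertex])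

lemma measure_branch_le_power: "measure \<mu> (branch x k) \<le> (1/2) ^ k"
proof (induction k)
  case (Suc k)
  then show ?case using measure_branch_half[of x k] by simp
qed simp

lemma sum_inverse_measure_branch: "(\<Sum>j<k. 1 / measure \<mu> (branch x j)) \<le> 1 / measure \<mu> (branch x k)"
proof (induction k)
  case (Suc k)
  have "(\<Sum>j<Suc k. 1 / measure \<mu> (branch x j)) \<le> 2 / measure \<mu> (branch x k)" using Suc by simp
  also have "\<dots> \<le> 1 / measure \<mu> (branch x (Suc k))"
    using measure_branch_half[of x k] measure_branch_pos[of x k] measure_branch_pos[of x "Suc k"]
    by (simp add: field_simps del: branch.simps measure_branch_pos)
  finally show ?case .
qed simp

lemma haar_diag: "haar x k x = 1 / measure \<mu> (branch x (Suc k)) - 1 / measure \<mu> (branch x k)"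
  using branch_self[of x k] branch_self[of x "Suc k"] by (simp add: haar_def ball_mean_def del: branch.simps)

lemma haar_diag_ge: "1 / measure \<mu> (branch x k) \<le> haar x k x"
proof -
  have "2 / measure \<mu> (branch x k) \<le> 1 / measure \<mu> (branch x (Suc k))"
    using measure_branch_half[of x k] measure_branch_pos[of x k] measure_branch_pos[of x "Suc k"]
    by (simp add: field_simps del: branch.simps measure_branch_pos)
  then show ?thesis by (simp add: haar_diag del: branch.simps)
qed

lemma haar_diag_nonneg: "0 \<le> haar x k x"
  using haar_diag_ge[of x k] measure_branch_pos[of x k] by (meson divide_nonneg_pos order_trans zero_le_one)

text \<open>The value on the diagonal only depends on the vertex: all of its children have the same mass.\<close>

lemma haar_diag_const:
  assumes "y \<in> branch x k" shows "haar y k y = haar x k x"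
  using branch_eq[OF assms] by (simp only: haar_diag measure_branch_Suc)

lemma haar_eigenvalue_branch:
  "haar_eigenvalue s (branch x k) = (\<Sum>j<k. diameter (branch x j) powr (s - 2) / measure \<mu> (branch x j))
    + diameter (branch x k) powr (s - 2) / (measure \<mu> (branch x k) - measure \<mu> (branch x (Suc k)))"
  unfolding haar_eigenvalue_def ancestors_branch measure_branch_Suc
  by (subst sum.reindex) (auto intro: inj_on_subset[OF inj_branch])

end

section \<open>Eigenspaces in terms of Haar functions\<close>

locale vp_spectrum = equity_cantor \<mu> for \<mu> :: "'a::metric_space measure" +
  fixes s :: real and I :: "'i set" and eig :: "'i \<Rightarrow> real" and \<phi> :: "'i \<Rightarrow> 'a \<Rightarrow> complex"
  assumes basis: "vp_test_eigenbasis \<mu> s I eig \<phi>"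
    and summ: "(\<lambda>i. inverse (eig i)) summable_on pos_indices I eig"
begin

abbreviation "eigenspace l \<equiv> {i \<in> I. eig i = l}"

lemma test_phi: "i \<in> I \<Longrightarrow> \<phi> i \<in> test_functions"
  using basis by (simp add: vp_test_eigenbasis_def)

lemma phi_orthonormal: "i \<in> I \<Longrightarrow> j \<in> I \<Longrightarrow> L2_inner \<mu> (\<phi> i) (\<phi> j) = (if i = j then 1 else 0)"
  using basis by (simp add: vp_test_eigenbasis_def)

lemma inverse_sum_le:
  assumes "finite F" "F \<subseteq> pos_indices I eig"
  shows "(\<Sum>i\<in>F. inverse (eig i)) \<le> (\<Sum>\<^sub>\<infinity>i\<in>pos_indices I eig. inverse (eig i))"
  by (rule finite_sum_le_infsum[OF summ]) (use assms in \<open>auto simp: pos_indices_def\<close>)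

text \<open>Each member of the eigenspace contributes \<open>1/l\<close> to the convergent sum.\<close>

lemma finite_eigenspace:
  assumes "l > 0"
  shows "finite (eigenspace l)" "real (card (eigenspace l)) \<le> l * (\<Sum>\<^sub>\<infinity>i\<in>pos_indices I eig. inverse (eig i))"
proof -
  let ?S = "\<Sum>\<^sub>\<infinity>i\<in>pos_indices I eig. inverse (eig i)"
  have *: "real (card F) \<le> l * ?S" if "finite F" "F \<subseteq> eigenspace l" for F
  proof -
    have "(\<Sum>i\<in>F. inverse (eig i)) = real (card F) * inverse l" using that(2) by (subst sum.cong[of F F _ "\<lambda>_. inverse l"]) auto
    moreover have "(\<Sum>i\<in>F. inverse (eig i)) \<le> ?S"
      using that assms by (intro inverse_sum_le) (auto simp: pos_indices_def)
    ultimately have "real (card F) * inverse l \<le> ?S" by simp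
    from mult_left_mono[OF this, of l] assms have "l * (real (card F) * inverse l) \<le> l * ?S" by simp
    then show ?thesis using assms by (simp add: field_simps del: mult_le_cancel_left_pos)
  qed
  show fin: "finite (eigenspace l)"
  proof (rule ccontr)
    assume "infinite (eigenspace l)"
    then obtain F where F: "F \<subseteq> eigenspace l" "finite F" "card F = Suc (nat \<lfloor>l * ?S\<rfloor>)"
      using infinite_arbitrarily_large by blast
    then show False using *[OF F(2,1)] by linarith
  qed
  show "real (card (eigenspace l)) \<le> l * ?S" using *[OF fin] by blast
qed

lemma phi_orthogonal_eigen:
  assumes i: "i \<in> I" and h: "h \<in> test_functions" "\<And>z. vladimirov_pearson \<mu> s h z = of_real l * h z"
    and ne: "eig i \<noteq> l"
  shows "L2_inner \<mu> (\<phi> i) h = 0"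
proof -
  have "(\<phi> i, \<lambda>x. of_real (eig i) * \<phi> i x) \<in> vladimirov_pearson_closure \<mu> s"
    using basis i by (simp add: vp_test_eigenbasis_def)
  from closure_weak_eigen[OF this h]
  have "L2_inner \<mu> (\<lambda>x. of_real (eig i) * \<phi> i x) h = of_real l * L2_inner \<mu> (\<phi> i) h" .
  moreover have "L2_inner \<mu> (\<lambda>x. of_real (eig i) * \<phi> i x) h = of_real (eig i) * L2_inner \<mu> (\<phi> i) h"
    unfolding L2_inner_def by (simp add: mult.assoc)
  ultimately have "of_real (eig i - l) * L2_inner \<mu> (\<phi> i) h = 0" by (simp add: algebra_simps)
  then show ?thesis using ne by simp
qed

text \<open>The remainder \<open>r\<close> of the expansion is orthogonal to all \<open>\<phi>\<^sub>i\<close>. As their span is dense, \<open>r\<close> vanishes in \<open>L\<^sup>2\<close>,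
hence pointwise.\<close>

lemma eigenfunction_expansion:
  assumes h: "h \<in> test_functions" "\<And>z. vladimirov_pearson \<mu> s h z = of_real l * h z" and l: "l > 0"
  shows "h y = (\<Sum>i\<in>eigenspace l. L2_inner \<mu> (\<phi> i) h * \<phi> i y)"
proof -
  define r where "r y = h y - (\<Sum>i\<in>eigenspace l. L2_inner \<mu> (\<phi> i) h * \<phi> i y)" for y
  note fin = finite_eigenspace(1)[OF l]
  have tsum: "(\<lambda>y. \<Sum>i\<in>J. c i * \<phi> i y) \<in> test_functions" if "J \<subseteq> I" for J c
    using that by (intro test_sum test_unop[of _ "\<lambda>a. c _ * a"] test_phi) auto
  have tr: "r \<in> test_functions" unfolding r_def[abs_def]
    by (intro test_binop[of _ _ "\<lambda>a b. a - b"] h tsum) auto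
  have r_orth: "L2_inner \<mu> (\<phi> j) r = 0" if j: "j \<in> I" for j
  proof -
    have "L2_inner \<mu> (\<phi> j) r = L2_inner \<mu> (\<phi> j) h - L2_inner \<mu> (\<phi> j) (\<lambda>y. \<Sum>i\<in>eigenspace l. L2_inner \<mu> (\<phi> i) h * \<phi> i y)"
      unfolding r_def[abs_def] by (intro L2_inner_diff_right h tsum test_phi j) auto
    also have "L2_inner \<mu> (\<phi> j) (\<lambda>y. \<Sum>i\<in>eigenspace l. L2_inner \<mu> (\<phi> i) h * \<phi> i y)
        = (\<Sum>i\<in>eigenspace l. L2_inner \<mu> (\<phi> i) h * L2_inner \<mu> (\<phi> j) (\<phi> i))"
      by (intro L2_inner_sum_right test_phi j) auto
    also have "\<dots> = (\<Sum>i\<in>eigenspace l. if j = i then L2_inner \<mu> (\<phi> j) h else 0)"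
      using j by (intro sum.cong) (auto simp: phi_orthonormal)
    also have "\<dots> = (if eig j = l then L2_inner \<mu> (\<phi> j) h else 0)" using fin j by simp
    also have "\<dots> = L2_inner \<mu> (\<phi> j) h" using phi_orthogonal_eigen[OF j h] by auto
    finally show ?thesis by simp
  qed
  \<comment> \<open>An approximation \<open>p\<close> of \<open>r\<close> in the span is orthogonal to \<open>r\<close>, so \<open>|r|\<^sup>2 \<le> |r - p|\<^sup>2\<close>.\<close>
  have small: "(LINT x|\<mu>. (norm (r x))\<^sup>2) \<le> e" if e: "e > 0" for e
  proof -
    obtain J c where J: "finite J" "J \<subseteq> I" "L2_sqdist \<mu> r (\<lambda>x. \<Sum>j\<in>J. c j * \<phi> j x) < ennreal e"
      using basis test_L2[OF tr] e unfolding vp_test_eigenbasis_def by (metis ennreal_less_zero_iff)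
    define p where "p x = (\<Sum>j\<in>J. c j * \<phi> j x)" for x
    have tp: "p \<in> test_functions" unfolding p_def[abs_def] by (rule tsum[OF J(2)])
    have "L2_inner \<mu> r p = (\<Sum>j\<in>J. c j * L2_inner \<mu> r (\<phi> j))"
      unfolding p_def[abs_def] using J by (intro L2_inner_sum_right tr test_phi) auto
    also have "\<dots> = 0" using r_orth J L2_inner_commute[of \<mu> r] by (intro sum.neutral) auto
    finally have rp: "(LINT x|\<mu>. Re (cnj (r x) * p x)) = 0"
      using integral_Re[OF test_integrable[OF test_inner[OF tr tp]]] by (simp add: L2_inner_def)
    have int: "integrable \<mu> (\<lambda>x. (norm (r x))\<^sup>2)" "integrable \<mu> (\<lambda>x. (norm (p x))\<^sup>2)"
      "integrable \<mu> (\<lambda>x. (norm (r x - p x))\<^sup>2)" "integrable \<mu> (\<lambda>x. Re (cnj (r x) * p x))"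
      using test_L2[OF tr] test_L2[OF tp] L2_diff[OF test_L2[OF tr] test_L2[OF tp]]
        integrable_Re[OF test_integrable[OF test_inner[OF tr tp]]]
      unfolding L2_functions_def by blast+
    have "(LINT x|\<mu>. (norm (r x))\<^sup>2) = (LINT x|\<mu>. (norm (r x))\<^sup>2) - 2 * (LINT x|\<mu>. Re (cnj (r x) * p x))"
      using rp by simp
    also have "\<dots> = (LINT x|\<mu>. (norm (r x))\<^sup>2 - 2 * Re (cnj (r x) * p x))"
      using Bochner_Integration.integral_diff[OF int(1) integrable_mult_right[OF int(4), of 2]]
      unfolding integral_mult_right_zero by (rule sym)
    also have "\<dots> \<le> (LINT x|\<mu>. (norm (r x - p x))\<^sup>2)"
    proof (rule integral_mono)
      fix x
      have "(norm (r x - p x))\<^sup>2 = (norm (r x))\<^sup>2 + (norm (p x))\<^sup>2 - 2 * Re (cnj (r x) * p x)"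
        unfolding cmod_power2 by (simp add: power2_eq_square algebra_simps)
      then show "(norm (r x))\<^sup>2 - 2 * Re (cnj (r x) * p x) \<le> (norm (r x - p x))\<^sup>2" by simp
    qed (rule Bochner_Integration.integrable_diff integrable_mult_right int)+
    also have "\<dots> \<le> e"
    proof -
      have "ennreal (LINT x|\<mu>. (norm (r x - p x))\<^sup>2) = L2_sqdist \<mu> r p"
        unfolding L2_sqdist_def by (intro nn_integral_eq_integral[symmetric] int) auto
      also have "\<dots> < ennreal e" using J(3) by (simp add: p_def[abs_def])
      finally show ?thesis using e by (simp add: ennreal_less_iff)
    qed
    finally show ?thesis .
  qed
  have "r y = 0" by (rule test_zero[OF tr]) (rule field_le_epsilon, use small in simp)
  then show ?thesis by (simp add: r_def)
qed

abbreviation lam :: "'a \<Rightarrow> nat \<Rightarrow> real" where "lam x k \<equiv> haar_eigenvalue s (branch x k)"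

text \<open>One summand of the eigenvalue, with the mass \<open>\<mu> v - m\<close> of the other children estimated by \<open>\<mu> v\<close>.\<close>

lemma lam_ge: "diameter (branch x k) powr (s - 2) / measure \<mu> (branch x k) \<le> lam x k"
proof -
  let ?v = "branch x k"
  have m: "0 < measure \<mu> ?v - child_mass ?v" "measure \<mu> ?v - child_mass ?v \<le> measure \<mu> ?v"
    using child_mass_bounds[OF branch_vertex[of x k]] measure_branch_pos[of x k] by auto
  have "diameter ?v powr (s - 2) / measure \<mu> ?v \<le> diameter ?v powr (s - 2) / (measure \<mu> ?v - child_mass ?v)"
    using m by (intro divide_left_mono) auto
  moreover have "0 \<le> (\<Sum>w | w \<in> V \<and> ?v \<subset> w. diameter w powr (s - 2) / measure \<mu> w)"
    by (intro sum_nonneg) auto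
  ultimately show ?thesis by (simp add: haar_eigenvalue_def)
qed

lemma lam_pos: "lam x k > 0"
  by (rule less_le_trans[OF _ lam_ge]) (use diameter_pos[OF branch_vertex[of x k]] in simp)

lemma phi_haar_orthogonal: "i \<in> I \<Longrightarrow> eig i \<noteq> lam x k \<Longrightarrow> L2_inner \<mu> (\<phi> i) (haar_c x k) = 0"
  by (rule phi_orthogonal_eigen) (auto simp: vladimirov_pearson_haar intro: test_haar)

lemma phi_one_orthogonal: "i \<in> I \<Longrightarrow> eig i \<noteq> 0 \<Longrightarrow> L2_inner \<mu> (\<phi> i) (\<lambda>_. 1) = 0"
  by (rule phi_orthogonal_eigen) (auto simp: vladimirov_pearson_one intro: test_const)

lemma haar_as_sum: "haar_c x k y = (\<Sum>i\<in>eigenspace (lam x k). L2_inner \<mu> (\<phi> i) (haar_c x k) * \<phi> i y)"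
  by (rule eigenfunction_expansion[OF test_haar vladimirov_pearson_haar lam_pos])

text \<open>The kernel of the spectral projection for \<open>l\<close>. In the expansion of \<open>cnj \<phi>\<^sub>i(x)\<close> along the branch of \<open>x\<close> only
Haar functions with eigenvalue \<open>l\<close> survive; after exchanging the sums, the sum over \<open>i\<close> is the expansion of
\<open>h\<^sub>k(y)\<close> in the eigenbasis. The bound \<open>N\<close> only has to make all members of the finite eigenspace constant on the
ball \<open>b\<^sub>N\<close>.\<close>

lemma eigenspace_kernel:
  assumes l: "l > 0"
  obtains N where "\<And>n y. N \<le> n \<Longrightarrow> (\<Sum>i\<in>eigenspace l. \<phi> i y * cnj (\<phi> i x))
     = of_real (\<Sum>k | k < n \<and> lam x k = l. haar x k y)"
proof -
  note fin = finite_eigenspace(1)[OF l]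
  have "\<exists>r>0. \<forall>i\<in>eigenspace l. const_at_scale r (\<phi> i)"
  proof -
    obtain q where q: "\<And>i. i \<in> eigenspace l \<Longrightarrow> const_at_scale (q i) (\<phi> i)"
      using test_phi unfolding test_functions_iff by (metis (mono_tags, lifting) mem_Collect_eq)
    define r where "r = Min (insert 1 (q ` eigenspace l))"
    have "r > 0" unfolding r_def using fin q by (auto simp: const_at_scale_def)
    moreover have "r \<le> q i" if "i \<in> eigenspace l" for i unfolding r_def using fin that by auto
    ultimately show ?thesis using q const_at_scale_mono by blast
  qed
  then obtain r where r: "r > 0" "\<And>i. i \<in> eigenspace l \<Longrightarrow> const_at_scale r (\<phi> i)" by blast
  obtain N where N: "\<And>n. N \<le> n \<Longrightarrow> diameter (branch x n) < r" using branch_shrinks[OF r(1)] by blast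
  show thesis
  proof (rule that[of N])
    fix n y assume n: "N \<le> n"
    let ?K = "{k. k < n \<and> lam x k = l}"
    have cn: "cnj (\<phi> i x) = (\<Sum>k\<in>?K. L2_inner \<mu> (\<phi> i) (haar_c x k))" if i: "i \<in> eigenspace l" for i
    proof -
      have "cnj (\<phi> i x) = L2_inner \<mu> (\<phi> i) (\<lambda>_. 1) + (\<Sum>k<n. L2_inner \<mu> (\<phi> i) (haar_c x k))"
        by (rule haar_expansion[OF r(2)[OF i] N[OF n]])
      also have "L2_inner \<mu> (\<phi> i) (\<lambda>_. 1) = 0" using i l by (intro phi_one_orthogonal) auto
      also have "(\<Sum>k<n. L2_inner \<mu> (\<phi> i) (haar_c x k)) = (\<Sum>k\<in>?K. L2_inner \<mu> (\<phi> i) (haar_c x k))"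
      proof (intro sum.mono_neutral_right ballI)
        fix k assume "k \<in> {..<n} - ?K"
        then have "eig i \<noteq> lam x k" using i by auto
        then show "L2_inner \<mu> (\<phi> i) (haar_c x k) = 0" using i phi_haar_orthogonal by blast
      qed auto
      finally show ?thesis by simp
    qed
    have "(\<Sum>i\<in>eigenspace l. \<phi> i y * cnj (\<phi> i x)) = (\<Sum>i\<in>eigenspace l. \<Sum>k\<in>?K. L2_inner \<mu> (\<phi> i) (haar_c x k) * \<phi> i y)"
      by (intro sum.cong refl) (simp add: cn sum_distrib_left mult.commute)
    also have "\<dots> = (\<Sum>k\<in>?K. \<Sum>i\<in>eigenspace l. L2_inner \<mu> (\<phi> i) (haar_c x k) * \<phi> i y)"
      by (rule sum.swap)
    also have "\<dots> = (\<Sum>k\<in>?K. haar_c x k y)"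
      using haar_as_sum[of x _ y] by (intro sum.cong) auto
    finally show "(\<Sum>i\<in>eigenspace l. \<phi> i y * cnj (\<phi> i x)) = of_real (\<Sum>k | k < n \<and> lam x k = l. haar x k y)"
      by simp
  qed
qed

section \<open>Diagonal sums and growth of the eigenvalues\<close>

abbreviation pos :: "'i set" where "pos \<equiv> pos_indices I eig"
abbreviation total :: real where "total \<equiv> \<Sum>\<^sub>\<infinity>i\<in>pos. inverse (eig i)"

lemma eigenspace_diag:
  assumes l: "l > 0"
  obtains N where "\<And>n. N \<le> n \<Longrightarrow> (\<Sum>i\<in>eigenspace l. (norm (\<phi> i x))\<^sup>2) = (\<Sum>k | k < n \<and> lam x k = l. haar x k x)"
proof -
  obtain N where N: "\<And>n y. N \<le> n \<Longrightarrow> (\<Sum>i\<in>eigenspace l. \<phi> i y * cnj (\<phi> i x))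
     = of_real (\<Sum>k | k < n \<and> lam x k = l. haar x k y)" by (rule eigenspace_kernel[OF l, where x = x], erule that)
  show thesis
  proof (rule that[of N])
    fix n assume "N \<le> n"
    have "complex_of_real (\<Sum>i\<in>eigenspace l. (norm (\<phi> i x))\<^sup>2) = (\<Sum>i\<in>eigenspace l. \<phi> i x * cnj (\<phi> i x))"
      by (simp only: of_real_sum complex_norm_square)
    then show "(\<Sum>i\<in>eigenspace l. (norm (\<phi> i x))\<^sup>2) = (\<Sum>k | k < n \<and> lam x k = l. haar x k x)"
      unfolding N[OF \<open>N \<le> n\<close>] of_real_eq_iff .
  qed
qed

lemma haar_le_eigenspace:
  assumes l: "l > 0"
  shows "(\<Sum>k | k < n \<and> lam x k = l. haar x k x) \<le> (\<Sum>i\<in>eigenspace l. (norm (\<phi> i x))\<^sup>2)"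
proof -
  obtain N where N: "\<And>n. N \<le> n \<Longrightarrow> (\<Sum>i\<in>eigenspace l. (norm (\<phi> i x))\<^sup>2) = (\<Sum>k | k < n \<and> lam x k = l. haar x k x)"
    by (rule eigenspace_diag[OF l, where x = x], erule that)
  have "(\<Sum>k | k < n \<and> lam x k = l. haar x k x) \<le> (\<Sum>k | k < max N n \<and> lam x k = l. haar x k x)"
    by (rule sum_mono2) (auto intro: haar_diag_nonneg)
  then show ?thesis using N[of "max N n"] by simp
qed

text \<open>This and the next lemma compare sums over the eigenbasis on the diagonal with sums along a branch, for an
arbitrary nonnegative function of the eigenvalue. They follow from the diagonal of the spectral projections by
sorting both sides by eigenvalue.\<close>

lemma weighted_haar_le:
  assumes F: "\<And>l. 0 \<le> F l"
  obtains J where "finite J" "J \<subseteq> pos"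
    "(\<Sum>k<n. F (lam x k) * haar x k x) \<le> (\<Sum>i\<in>J. F (eig i) * (norm (\<phi> i x))\<^sup>2)"
proof -
  define L where "L = lam x ` {..<n}"
  have L: "finite L" "\<And>l. l \<in> L \<Longrightarrow> l > 0" by (auto simp: L_def lam_pos)
  define J where "J = (\<Union>l\<in>L. eigenspace l)"
  have J: "finite J" "J \<subseteq> pos" using L finite_eigenspace(1) by (auto simp: J_def pos_indices_def)
  have "(\<Sum>k<n. F (lam x k) * haar x k x) = (\<Sum>l\<in>L. \<Sum>k | k \<in> {..<n} \<and> lam x k = l. F (lam x k) * haar x k x)"
    by (rule sum.group[symmetric]) (auto simp: L_def)
  also have "\<dots> = (\<Sum>l\<in>L. F l * (\<Sum>k | k < n \<and> lam x k = l. haar x k x))"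
    by (simp add: sum_distrib_left)
  also have "\<dots> \<le> (\<Sum>l\<in>L. F l * (\<Sum>i\<in>eigenspace l. (norm (\<phi> i x))\<^sup>2))"
    by (intro sum_mono mult_left_mono haar_le_eigenspace L F)
  also have "\<dots> = (\<Sum>l\<in>L. \<Sum>i\<in>{i\<in>J. eig i = l}. F (eig i) * (norm (\<phi> i x))\<^sup>2)"
  proof (intro sum.cong refl)
    fix l assume "l \<in> L"
    then have "{i\<in>J. eig i = l} = eigenspace l" by (auto simp: J_def)
    then show "F l * (\<Sum>i\<in>eigenspace l. (norm (\<phi> i x))\<^sup>2) = (\<Sum>i\<in>{i\<in>J. eig i = l}. F (eig i) * (norm (\<phi> i x))\<^sup>2)"
      by (simp add: sum_distrib_left)
  qed
  also have "\<dots> = (\<Sum>i\<in>J. F (eig i) * (norm (\<phi> i x))\<^sup>2)"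
    by (rule sum.group) (use J L in \<open>auto simp: J_def\<close>)
  finally show thesis by (rule that[OF J])
qed

lemma weighted_phi_le:
  assumes F: "\<And>l. 0 \<le> F l" and J: "finite J" "J \<subseteq> pos"
  obtains n where "(\<Sum>i\<in>J. F (eig i) * (norm (\<phi> i x))\<^sup>2) \<le> (\<Sum>k<n. F (lam x k) * haar x k x)"
proof -
  define L where "L = eig ` J"
  have L: "finite L" "\<And>l. l \<in> L \<Longrightarrow> l > 0" using J by (auto simp: L_def pos_indices_def)
  have "\<forall>l\<in>L. \<exists>N. \<forall>n\<ge>N. (\<Sum>i\<in>eigenspace l. (norm (\<phi> i x))\<^sup>2) = (\<Sum>k | k < n \<and> lam x k = l. haar x k x)"
    using eigenspace_diag[where x = x, OF L(2)] by meson
  from bchoice[OF this] obtain N where N: "\<And>l n. l \<in> L \<Longrightarrow> N l \<le> n \<Longrightarrow>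
      (\<Sum>i\<in>eigenspace l. (norm (\<phi> i x))\<^sup>2) = (\<Sum>k | k < n \<and> lam x k = l. haar x k x)"
    by blast
  define n where "n = Max (insert 0 (N ` L))"
  have n: "N l \<le> n" if "l \<in> L" for l unfolding n_def using that L(1) by auto
  have "(\<Sum>i\<in>J. F (eig i) * (norm (\<phi> i x))\<^sup>2) = (\<Sum>l\<in>L. \<Sum>i\<in>{i\<in>J. eig i = l}. F (eig i) * (norm (\<phi> i x))\<^sup>2)"
    by (rule sum.group[symmetric]) (use J L in \<open>auto simp: L_def\<close>)
  also have "\<dots> \<le> (\<Sum>l\<in>L. F l * (\<Sum>i\<in>eigenspace l. (norm (\<phi> i x))\<^sup>2))"
  proof (rule sum_mono)
    fix l assume l: "l \<in> L"
    have "(\<Sum>i\<in>{i\<in>J. eig i = l}. F (eig i) * (norm (\<phi> i x))\<^sup>2) \<le> (\<Sum>i\<in>eigenspace l. F (eig i) * (norm (\<phi> i x))\<^sup>2)"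
      using J F finite_eigenspace(1)[OF L(2)[OF l]] by (intro sum_mono2) (auto simp: pos_indices_def)
    then show "(\<Sum>i\<in>{i\<in>J. eig i = l}. F (eig i) * (norm (\<phi> i x))\<^sup>2) \<le> F l * (\<Sum>i\<in>eigenspace l. (norm (\<phi> i x))\<^sup>2)"
      by (simp add: sum_distrib_left)
  qed
  also have "\<dots> = (\<Sum>l\<in>L. F l * (\<Sum>k | k < n \<and> lam x k = l. haar x k x))"
    using N n by (intro sum.cong) auto
  also have "\<dots> = (\<Sum>l\<in>L. \<Sum>k | k \<in> {k. k < n \<and> lam x k \<in> L} \<and> lam x k = l. F (lam x k) * haar x k x)"
  proof (intro sum.cong refl)
    fix l assume "l \<in> L"
    then have "{k. k \<in> {k. k < n \<and> lam x k \<in> L} \<and> lam x k = l} = {k. k < n \<and> lam x k = l}" by auto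
    then show "F l * (\<Sum>k | k < n \<and> lam x k = l. haar x k x)
      = (\<Sum>k | k \<in> {k. k < n \<and> lam x k \<in> L} \<and> lam x k = l. F (lam x k) * haar x k x)"
      by (simp add: sum_distrib_left)
  qed
  also have "\<dots> = (\<Sum>k | k < n \<and> lam x k \<in> L. F (lam x k) * haar x k x)"
    by (rule sum.group) (use L in auto)
  also have "\<dots> \<le> (\<Sum>k<n. F (lam x k) * haar x k x)"
    by (rule sum_mono2) (auto intro!: mult_nonneg_nonneg F haar_diag_nonneg)
  finally show thesis by (rule that)
qed

lemma countable_pos: "countable pos"
proof -
  have "{i \<in> pos. inverse (eig i) \<noteq> 0} = pos" by (auto simp: pos_indices_def)
  then show ?thesis using summable_countable_real[OF summ] by simp
qed

lemma integral_phi_square: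
  assumes "i \<in> I"
  shows "integrable \<mu> (\<lambda>x. (norm (\<phi> i x))\<^sup>2)" "(LINT x|\<mu>. (norm (\<phi> i x))\<^sup>2) = 1"
proof -
  note int = test_integrable[OF test_inner[OF test_phi[OF assms] test_phi[OF assms]]]
  show "integrable \<mu> (\<lambda>x. (norm (\<phi> i x))\<^sup>2)" using test_L2[OF test_phi[OF assms]] by (simp add: L2_functions_def)
  have "(LINT x|\<mu>. (norm (\<phi> i x))\<^sup>2) = (LINT x|\<mu>. Re (cnj (\<phi> i x) * \<phi> i x))"
    by (intro Bochner_Integration.integral_cong refl) (simp add: cmod_power2, simp add: power2_eq_square)
  also have "\<dots> = Re (L2_inner \<mu> (\<phi> i) (\<phi> i))"
    unfolding L2_inner_def by (rule integral_Re[OF int])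
  finally show "(LINT x|\<mu>. (norm (\<phi> i x))\<^sup>2) = 1" using phi_orthonormal[OF assms assms] by simp
qed

text \<open>By Tonelli's theorem \<open>\<Sum> |\<phi>\<^sub>i|\<^sup>2/\<lambda>\<^sub>i\<close> has the integral \<open>\<Sum> 1/\<lambda>\<^sub>i\<close>, so it is finite almost
everywhere.\<close>

lemma AE_green_diag_finite: "AE x in \<mu>. x \<in> green_diag_finite I eig \<phi>"
proof -
  define g where "g i x = ennreal (inverse (eig i) * (norm (\<phi> i x))\<^sup>2)" for i x
  have meas: "g i \<in> borel_measurable \<mu>" if "i \<in> pos" for i
    using that integral_phi_square(1)[of i] unfolding g_def by (auto simp: pos_indices_def)
  have "(\<integral>\<^sup>+x. \<integral>\<^sup>+i. g i x \<partial>count_space pos \<partial>\<mu>) = (\<integral>\<^sup>+i. \<integral>\<^sup>+x. g i x \<partial>\<mu> \<partial>count_space pos)"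
    by (rule nn_integral_count_space_nn_integral[OF countable_pos meas])
  also have "\<dots> = (\<integral>\<^sup>+i. ennreal (inverse (eig i)) \<partial>count_space pos)"
  proof (intro nn_integral_cong)
    fix i assume "i \<in> space (count_space pos)"
    then have i: "i \<in> I" "eig i > 0" by (auto simp: pos_indices_def)
    have "(\<integral>\<^sup>+x. g i x \<partial>\<mu>) = ennreal (LINT x|\<mu>. inverse (eig i) * (norm (\<phi> i x))\<^sup>2)"
      unfolding g_def using i integral_phi_square(1)[OF i(1)] by (intro nn_integral_eq_integral) auto
    also have "\<dots> = ennreal (inverse (eig i))" using integral_phi_square(2)[OF i(1)] by simp
    finally show "(\<integral>\<^sup>+x. g i x \<partial>\<mu>) = ennreal (inverse (eig i))" .
  qed
  also have "\<dots> = ennreal total"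
    unfolding nn_integral_count_space_eq_infsum[OF countable_pos]
    by (rule ennreal_infsum[OF summ, symmetric]) (auto simp: pos_indices_def)
  also have "\<dots> < \<infinity>" by simp
  finally have fin: "(\<integral>\<^sup>+x. \<integral>\<^sup>+i. g i x \<partial>count_space pos \<partial>\<mu>) \<noteq> \<infinity>" by simp
  have "(\<lambda>x. \<integral>\<^sup>+i. g i x \<partial>count_space pos) \<in> borel_measurable \<mu>"
  proof -
    interpret C: sigma_finite_measure "count_space pos" using countable_pos by (rule sigma_finite_measure_count_space_countable)
    have "(\<lambda>(i,x). g i x) \<in> borel_measurable (count_space pos \<Otimes>\<^sub>M \<mu>)"
      using countable_pos by (rule measurable_pair_measure_countable1) (simp add: meas)
    then have "(\<lambda>(x,i). g i x) \<in> borel_measurable (\<mu> \<Otimes>\<^sub>M count_space pos)"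
      by (subst measurable_pair_swap_iff) (simp add: case_prod_unfold)
    then show ?thesis by (rule C.borel_measurable_nn_integral)
  qed
  then have "AE x in \<mu>. (\<integral>\<^sup>+i. g i x \<partial>count_space pos) \<noteq> \<infinity>"
    by (rule nn_integral_PInf_AE[OF _ fin])
  then show ?thesis
  proof (rule eventually_mono)
    fix x assume "(\<integral>\<^sup>+i. g i x \<partial>count_space pos) \<noteq> \<infinity>"
    then have "(\<lambda>i. inverse (eig i) * (norm (\<phi> i x))\<^sup>2) summable_on pos"
      unfolding nn_integral_count_space_eq_infsum[OF countable_pos] g_def
      by (rule summable_on_ennreal_finite) (auto simp: pos_indices_def)
    then show "x \<in> green_diag_finite I eig \<phi>" by (simp add: green_diag_finite_def)
  qed
qed

text \<open>If \<open>s \<ge> 2\<close>, then \<open>diam(w)\<^bsup>s-2\<^esup>\<close> is bounded by its value \<open>D\<close> at the root, and the masses along the branch at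
least halve in each step, so that \<open>\<lambda>\<^sub>k(x) \<le> 3 D / \<mu>(b\<^sub>k) \<le> 3 D h\<^sub>k(x)\<close>. Then \<open>\<Sum> h\<^sub>k(x)/\<lambda>\<^sub>k(x)\<close> diverges,
although it is bounded by \<open>\<Sum> |\<phi>\<^sub>i(x)|\<^sup>2/\<lambda>\<^sub>i\<close>, which is finite for some \<open>x\<close>.\<close>

lemma exponent_less_2: "s < 2"
proof (rule ccontr)
  assume "\<not> s < 2"
  then have s: "s \<ge> 2" by simp
  obtain x where x: "x \<in> green_diag_finite I eig \<phi>"
    using eventually_happens'[OF ae_filter_bot AE_green_diag_finite] by blast
  define D where "D = diameter (UNIV :: 'a set) powr (s - 2)"
  have D: "D > 0" using diameter_pos[OF UNIV_vertex] by (simp add: D_def)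
  have dD: "diameter (branch x j) powr (s - 2) \<le> D" for j
    unfolding D_def using s diameter_branch_le[of 0 j x] diameter_pos[OF branch_vertex[of x j]] by (intro powr_mono2) auto
  have lam_le: "lam x k \<le> 3 * D / measure \<mu> (branch x k)" for k
  proof -
    let ?a = "\<lambda>j. measure \<mu> (branch x j)"
    have "(\<Sum>j<k. diameter (branch x j) powr (s - 2) / ?a j) \<le> (\<Sum>j<k. D * (1 / ?a j))"
      by (intro sum_mono) (simp add: divide_right_mono dD)
    also have "\<dots> = D * (\<Sum>j<k. 1 / ?a j)" by (rule sum_distrib_left[symmetric])
    also have "\<dots> \<le> D * (1 / ?a k)" using D sum_inverse_measure_branch by (intro mult_left_mono) auto
    finally have 1: "(\<Sum>j<k. diameter (branch x j) powr (s - 2) / ?a j) \<le> D / ?a k" by simp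
    have h: "?a k / 2 \<le> ?a k - ?a (Suc k)" using measure_branch_half[of x k] by linarith
    have "diameter (branch x k) powr (s - 2) / (?a k - ?a (Suc k)) \<le> D / (?a k / 2)"
      using h D measure_branch_pos[of x k] by (intro frac_le dD) auto
    then have "diameter (branch x k) powr (s - 2) / (?a k - ?a (Suc k)) \<le> 2 * D / ?a k" by (simp add: mult.commute)
    then show ?thesis unfolding haar_eigenvalue_branch using 1 by (simp add: add_divide_distrib[symmetric] del: branch.simps)
  qed
  have ratio: "1 / (3 * D) \<le> inverse (lam x k) * haar x k x" for k
  proof -
    let ?a = "measure \<mu> (branch x k)"
    have a: "?a > 0" by simp
    have "1 / (3 * D) = inverse (3 * D / ?a) * (1 / ?a)" using a D by (simp add: field_simps del: measure_branch_pos)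
    also have "\<dots> \<le> inverse (lam x k) * haar x k x"
      using lam_pos[of x k] lam_le[of k] haar_diag_ge[of x k] a
      by (intro mult_mono le_imp_inverse_le) auto
    finally show ?thesis .
  qed
  let ?T = "\<Sum>\<^sub>\<infinity>i\<in>pos. inverse (eig i) * (norm (\<phi> i x))\<^sup>2"
  \<comment> \<open>The comparison requires a weight that is nonnegative on the whole line, hence the truncation.\<close>
  have "real n / (3 * D) \<le> ?T" for n
  proof -
    obtain J where J: "finite J" "J \<subseteq> pos"
      "(\<Sum>k<n. max 0 (inverse (lam x k)) * haar x k x) \<le> (\<Sum>i\<in>J. max 0 (inverse (eig i)) * (norm (\<phi> i x))\<^sup>2)"
      by (rule weighted_haar_le[where F = "\<lambda>l. max 0 (inverse l)" and n = n and x = x, OF max.cobounded1])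
    have "real n / (3 * D) = (\<Sum>k<n. 1 / (3 * D))" by simp
    also have "\<dots> \<le> (\<Sum>k<n. max 0 (inverse (lam x k)) * haar x k x)"
      using ratio lam_pos by (intro sum_mono) (auto simp: max_def less_imp_le not_le intro: order_trans)
    also have "\<dots> \<le> (\<Sum>i\<in>J. inverse (eig i) * (norm (\<phi> i x))\<^sup>2)"
      using J(2) by (intro order_trans[OF J(3)] eq_refl sum.cong) (auto simp: pos_indices_def max_def)
    also have "\<dots> \<le> ?T"
      using x J by (intro finite_sum_le_infsum) (auto simp: green_diag_finite_def pos_indices_def)
    finally show ?thesis .
  qed
  moreover obtain n where "?T * (3 * D) < real n" using reals_Archimedean2 by blast
  ultimately show False using D by (simp add: field_simps) (meson not_le)
qed

text \<open>The diagonal value \<open>h\<^sub>k(x)\<close> is the same for all points of the vertex and is at most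
\<open>\<Sum> |\<phi>\<^sub>i|\<^sup>2\<close> over the eigenspace. Integrating over the vertex bounds \<open>h\<^sub>k(x) \<mu>(b\<^sub>k)\<close> by the multiplicity of the
eigenvalue. The number of children of a vertex is not bounded a priori, so \<open>h\<^sub>k(x)\<close> cannot be estimated by
\<open>1/\<mu>(b\<^sub>k)\<close> alone.\<close>

lemma haar_diag_le: "haar x k x * measure \<mu> (branch x k) \<le> lam x k * total"
proof -
  note fin = finite_eigenspace[OF lam_pos[of x k]]
  have "haar x k x * measure \<mu> (branch x k) = (LINT y|\<mu>. indicator (branch x k) y * haar x k x)"
    using vertex_measurable[OF branch_vertex[of x k]] by simp
  also have "\<dots> \<le> (LINT y|\<mu>. (\<Sum>i\<in>eigenspace (lam x k). (norm (\<phi> i y))\<^sup>2))"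
  proof (rule integral_mono)
    show "integrable \<mu> (\<lambda>y. indicator (branch x k) y * haar x k x)"
      using vertex_measurable[OF branch_vertex[of x k]]
      by (intro integrable_mult_left integrable_real_indicator) (auto simp: less_top[symmetric])
    show "integrable \<mu> (\<lambda>y. (\<Sum>i\<in>eigenspace (lam x k). (norm (\<phi> i y))\<^sup>2))"
      by (intro Bochner_Integration.integrable_sum integral_phi_square) auto
    fix y
    show "indicator (branch x k) y * haar x k x \<le> (\<Sum>i\<in>eigenspace (lam x k). (norm (\<phi> i y))\<^sup>2)"
    proof (cases "y \<in> branch x k")
      case True
      have "haar x k x = haar y k y" using haar_diag_const[OF True] by simp
      also have "\<dots> \<le> (\<Sum>j | j < Suc k \<and> lam y j = lam y k. haar y j y)"
        by (rule member_le_sum) (auto intro: haar_diag_nonneg)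
      also have "\<dots> \<le> (\<Sum>i\<in>eigenspace (lam y k). (norm (\<phi> i y))\<^sup>2)" by (rule haar_le_eigenspace[OF lam_pos])
      also have "lam y k = lam x k" using branch_eq[OF True] by simp
      finally show ?thesis using True by simp
    next
      case False
      then show ?thesis by (simp add: sum_nonneg)
    qed
  qed
  also have "\<dots> = (\<Sum>i\<in>eigenspace (lam x k). (LINT y|\<mu>. (norm (\<phi> i y))\<^sup>2))"
    by (intro Bochner_Integration.integral_sum integral_phi_square) auto
  also have "\<dots> = real (card (eigenspace (lam x k)))" using integral_phi_square(2) by simp
  also have "\<dots> \<le> lam x k * total" by (rule fin(2))
  finally show ?thesis .
qed

lemma total_nonneg: "total \<ge> 0"
  by (rule infsum_nonneg) (auto simp: pos_indices_def)

text \<open>Combine \<open>exp(-t l) \<le> 27/(t l)\<^sup>3\<close>, \<open>h\<^sub>k(x) \<le> l S/\<mu>(b\<^sub>k)\<close> and \<open>l \<ge> c/\<mu>(b\<^sub>k)\<close> for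
\<open>l = \<lambda>\<^sub>k(x)\<close>, where \<open>S = \<Sum> 1/\<lambda>\<^sub>i\<close>: the terms are at most a constant times \<open>\<mu>(b\<^sub>k) \<le> 2\<^bsup>-k\<^esup>\<close>.\<close>

lemma heat_haar_bounded:
  assumes t: "t > 0"
  obtains M where "\<And>n. (\<Sum>k<n. exp (- t * lam x k) * haar x k x) \<le> M"
proof -
  define c where "c = diameter (UNIV :: 'a set) powr (s - 2)"
  have c: "c > 0" using diameter_pos[OF UNIV_vertex] by (simp add: c_def)
  define B where "B = 27 * total / (c\<^sup>2 * t ^ 3)"
  have B: "B \<ge> 0" using total_nonneg c t by (simp add: B_def)
  have decay: "exp (- t * lam x k) * haar x k x \<le> B * (1/2) ^ k" for k
  proof -
    let ?a = "measure \<mu> (branch x k)" and ?l = "lam x k"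
    have a: "?a > 0" and l: "?l > 0" by (simp, rule lam_pos)
    have "c \<le> diameter (branch x k) powr (s - 2)"
      unfolding c_def using exponent_less_2 diameter_branch_le[of 0 k x] diameter_pos[OF branch_vertex[of x k]]
      by (intro powr_mono2') auto
    then have "c / ?a \<le> ?l" using lam_ge[of x k] a by (meson divide_right_mono less_imp_le order_trans)
    then have ca: "c \<le> ?l * ?a" using a by (simp add: pos_divide_le_eq)
    have "(t * ?l / 3) ^ 3 \<le> (1 + t * ?l / real 3) ^ 3" using t l by (intro power_mono) auto
    also have "\<dots> \<le> exp (t * ?l)"
      using t l by (intro exp_ge_one_plus_x_over_n_power_n) (simp_all add: order_trans[of _ 0])
    finally have ex: "t ^ 3 * ?l ^ 3 / 27 \<le> exp (t * ?l)" by (simp add: power_mult_distrib power_divide)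
    have "exp (- t * ?l) = 1 / exp (t * ?l)" by (simp add: exp_minus divide_inverse)
    also have "\<dots> \<le> 1 / (t ^ 3 * ?l ^ 3 / 27)" using t l by (intro divide_left_mono ex) auto
    finally have e: "exp (- t * ?l) \<le> 27 / (t ^ 3 * ?l ^ 3)" by simp
    have h: "haar x k x \<le> ?l * total / ?a" using haar_diag_le[of x k] a by (simp add: pos_le_divide_eq)
    have "exp (- t * ?l) * haar x k x \<le> 27 / (t ^ 3 * ?l ^ 3) * (?l * total / ?a)"
      using t l haar_diag_nonneg by (intro mult_mono e h) auto
    also have "\<dots> = 27 * total / (t ^ 3) * ?a / (?l * ?a)\<^sup>2"
      using t l a by (simp add: field_simps power2_eq_square power3_eq_cube)
    also have "\<dots> \<le> 27 * total / (t ^ 3) * ?a / c\<^sup>2"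
    proof (intro divide_left_mono power_mono ca)
      show "0 < (?l * ?a)\<^sup>2 * c\<^sup>2" using l a c by (intro mult_pos_pos zero_less_power)
    qed (use t a c total_nonneg in auto)
    also have "\<dots> = B * ?a" by (simp add: B_def field_simps)
    also have "\<dots> \<le> B * (1/2) ^ k" by (intro mult_left_mono measure_branch_le_power B)
    finally show ?thesis .
  qed
  have "(\<Sum>k<n. exp (- t * lam x k) * haar x k x) \<le> B * 2" for n
  proof -
    have "(\<Sum>k<n. exp (- t * lam x k) * haar x k x) \<le> (\<Sum>k<n. B * (1/2) ^ k)" by (intro sum_mono decay)
    also have "\<dots> = B * (\<Sum>k<n. (1/2) ^ k)" by (rule sum_distrib_left[symmetric])
    also have "(\<Sum>k<n. (1/2::real) ^ k) \<le> 2" by (subst sum_gp_strict) auto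
    finally show ?thesis using B by (simp add: mult_left_mono)
  qed
  then show thesis by (rule that)
qed

section \<open>Heat kernel and Green function\<close>

lemma heat_diag_summable:
  assumes t: "t > 0"
  shows "(\<lambda>i. exp (- t * eig i) * (norm (\<phi> i x))\<^sup>2) summable_on pos"
proof (rule nonneg_bdd_above_summable_on)
  obtain M where M: "\<And>n. (\<Sum>k<n. exp (- t * lam x k) * haar x k x) \<le> M" using heat_haar_bounded[OF t] by blast
  show "bdd_above (sum (\<lambda>i. exp (- t * eig i) * (norm (\<phi> i x))\<^sup>2) ` {F. F \<subseteq> pos \<and> finite F})"
  proof (rule bdd_aboveI2)
    fix J assume "J \<in> {F. F \<subseteq> pos \<and> finite F}"
    then obtain n where "(\<Sum>i\<in>J. exp (- t * eig i) * (norm (\<phi> i x))\<^sup>2) \<le> (\<Sum>k<n. exp (- t * lam x k) * haar x k x)"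
      using weighted_phi_le[where F = "\<lambda>l. exp (- t * l)" and J = J and x = x] by auto
    then show "(\<Sum>i\<in>J. exp (- t * eig i) * (norm (\<phi> i x))\<^sup>2) \<le> M" using M order_trans by blast
  qed
qed auto

lemma product_summable:
  assumes w: "\<And>i. i \<in> pos \<Longrightarrow> 0 \<le> w i"
    and "(\<lambda>i. w i * (norm (\<phi> i x))\<^sup>2) summable_on pos" "(\<lambda>i. w i * (norm (\<phi> i y))\<^sup>2) summable_on pos"
  shows "(\<lambda>i. w i * norm (\<phi> i x * cnj (\<phi> i y))) summable_on pos"
proof (rule summable_on_comparison_test)
  show "(\<lambda>i. w i * (norm (\<phi> i x))\<^sup>2 + w i * (norm (\<phi> i y))\<^sup>2) summable_on pos"
    using assms(2,3) by (rule summable_on_add)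
  fix i assume i: "i \<in> pos"
  have "2 * (norm (\<phi> i x) * norm (\<phi> i y)) \<le> (norm (\<phi> i x))\<^sup>2 + (norm (\<phi> i y))\<^sup>2"
    using sum_squares_bound[of "norm (\<phi> i x)" "norm (\<phi> i y)"] by simp
  moreover have "0 \<le> norm (\<phi> i x) * norm (\<phi> i y)" by simp
  ultimately have "norm (\<phi> i x) * norm (\<phi> i y) \<le> (norm (\<phi> i x))\<^sup>2 + (norm (\<phi> i y))\<^sup>2" by linarith
  then show "w i * norm (\<phi> i x * cnj (\<phi> i y)) \<le> w i * (norm (\<phi> i x))\<^sup>2 + w i * (norm (\<phi> i y))\<^sup>2"
    using w[OF i] by (simp add: norm_mult mult_left_mono flip: distrib_left)
  show "0 \<le> w i * norm (\<phi> i x * cnj (\<phi> i y))" using w[OF i] by simp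
qed

lemma heat_term_eq: "heat_term eig \<phi> t x y i = of_real (exp (- t * eig i)) * (\<phi> i x * cnj (\<phi> i y))"
  by (simp add: heat_term_def mult.assoc)

lemma green_term_eq: "green_term eig \<phi> x y i = of_real (inverse (eig i)) * (\<phi> i x * cnj (\<phi> i y))"
  by (simp add: green_term_def mult.assoc)

lemma heat_term_summable:
  assumes t: "t > 0" shows "heat_term eig \<phi> t x y summable_on pos"
proof -
  have "(\<lambda>i. norm (heat_term eig \<phi> t x y i)) summable_on pos"
    using product_summable[OF _ heat_diag_summable[OF t] heat_diag_summable[OF t], of x y]
    unfolding heat_term_eq norm_mult by simp
  then show ?thesis by (rule abs_summable_summable)
qed

lemma heat_kernel_eq: "heat_kernel I eig \<phi> t x y = (\<Sum>\<^sub>\<infinity>i\<in>pos. of_real (exp (- t * eig i)) * (\<phi> i x * cnj (\<phi> i y)))"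
  unfolding heat_kernel_def heat_term_eq ..

lemma green_diag_finite_expansion:
  assumes "x \<in> green_diag_finite I eig \<phi>" "y \<in> green_diag_finite I eig \<phi>"
  shows "green_exists I eig \<phi> x y" "(green_term eig \<phi> x y has_sum green_function I eig \<phi> x y) pos"
proof -
  have s: "(\<lambda>i. norm (\<phi> i x * cnj (\<phi> i y)) / eig i) summable_on pos"
    using product_summable[of "\<lambda>i. inverse (eig i)" x y] assms
    by (simp add: green_diag_finite_def divide_inverse mult.commute pos_indices_def)
  have p: "\<And>i. i \<in> pos \<Longrightarrow> eig i > 0" by (simp add: pos_indices_def)
  show "green_exists I eig \<phi> x y"
    unfolding green_exists_def heat_kernel_eq by (rule laplace_sum(1)[OF countable_pos p s])
  show "(green_term eig \<phi> x y has_sum green_function I eig \<phi> x y) pos"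
    unfolding green_function_def heat_kernel_eq green_term_eq[abs_def]
    by (rule laplace_sum(2)[OF countable_pos p s])
qed

text \<open>Beyond some \<open>N\<close> the vertices on the branch of \<open>y\<close> do not contain \<open>x\<close>, so all spectral projections together
involve only the first \<open>N\<close> Haar functions at \<open>x\<close>. An eigenvalue of such a Haar function that is not among the
\<open>\<lambda>\<^sub>i\<close> has an empty eigenspace and contributes zero on both sides.\<close>

lemma off_diagonal:
  assumes "x \<noteq> y"
  obtains N where "\<And>F :: real \<Rightarrow> complex. ((\<lambda>l. F l * (\<Sum>i\<in>eigenspace l. \<phi> i x * cnj (\<phi> i y))) has_sum
      (\<Sum>k<N. F (lam y k) * of_real (haar y k x))) (eig ` pos)"
proof -
  obtain N where N: "\<And>n. N \<le> n \<Longrightarrow> diameter (branch y n) < dist x y"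
    using branch_shrinks[of "dist x y" y] assms by auto
  have z: "haar y k x = 0" if "N \<le> k" for k
    using N[OF that] dist_le_diameter[of x "branch y k" y] branch_self[of y k] by (intro haar_zero) force
  have ker: "(\<Sum>i\<in>eigenspace l. \<phi> i x * cnj (\<phi> i y)) = (\<Sum>k | k < N \<and> lam y k = l. of_real (haar y k x))"
    if l: "l > 0" for l
  proof -
    obtain N' where N': "\<And>n z. N' \<le> n \<Longrightarrow> (\<Sum>i\<in>eigenspace l. \<phi> i z * cnj (\<phi> i y))
        = of_real (\<Sum>k | k < n \<and> lam y k = l. haar y k z)"
      by (rule eigenspace_kernel[OF l, where x = y], erule that)
    have "(\<Sum>k | k < max N N' \<and> lam y k = l. haar y k x) = (\<Sum>k | k < N \<and> lam y k = l. haar y k x)"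
      by (rule sum.mono_neutral_right) (auto intro!: z)
    then show ?thesis using N'[of "max N N'" x] by simp
  qed
  show thesis
  proof (rule that[of N])
    fix F :: "real \<Rightarrow> complex"
    let ?g = "\<lambda>l. F l * (\<Sum>i\<in>eigenspace l. \<phi> i x * cnj (\<phi> i y))"
    let ?L = "lam y ` {..<N}"
    have "(\<Sum>k<N. F (lam y k) * of_real (haar y k x)) = (\<Sum>l\<in>?L. \<Sum>k | k \<in> {..<N} \<and> lam y k = l. F (lam y k) * of_real (haar y k x))"
      by (rule sum.group[symmetric]) auto
    also have "\<dots> = (\<Sum>l\<in>?L. ?g l)"
    proof (intro sum.cong refl)
      fix l assume "l \<in> ?L"
      then have "l > 0" using lam_pos by auto
      then show "(\<Sum>k | k \<in> {..<N} \<and> lam y k = l. F (lam y k) * of_real (haar y k x)) = ?g l"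
        by (simp add: ker sum_distrib_left)
    qed
    finally have "(?g has_sum (\<Sum>k<N. F (lam y k) * of_real (haar y k x))) ?L"
      by (intro has_sum_finiteI) auto
    then show "(?g has_sum (\<Sum>k<N. F (lam y k) * of_real (haar y k x))) (eig ` pos)"
    proof (rule has_sum_cong_neutral[THEN iffD1, rotated -1])
      fix l assume l: "l \<in> ?L - eig ` pos"
      then have "l > 0" using lam_pos by auto
      then have "eigenspace l \<subseteq> {i \<in> pos. eig i = l}" by (auto simp: pos_indices_def)
      then have e: "eigenspace l = {}" using l by blast
      show "?g l = 0" unfolding e by simp
    next
      fix l assume l: "l \<in> eig ` pos - ?L"
      have e: "{k. k < N \<and> lam y k = l} = {}" using l by blast
      have "l > 0" using l by (auto simp: pos_indices_def)
      then show "?g l = 0" unfolding ker[OF \<open>l > 0\<close>] e by simp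
    qed simp
  qed
qed

text \<open>The heat kernel converges absolutely, so it can be rearranged; summed by eigenvalue, it is a finite sum off
the diagonal.\<close>

lemma heat_kernel_by_eigenvalue:
  assumes t: "t > 0"
  shows "heat_kernel I eig \<phi> t x y =
    (\<Sum>\<^sub>\<infinity>l\<in>eig ` pos. of_real (exp (- t * l)) * (\<Sum>i\<in>eigenspace l. \<phi> i x * cnj (\<phi> i y)))"
proof -
  let ?f = "heat_term eig \<phi> t x y"
  have b: "bij_betw snd (Sigma (eig ` pos) eigenspace) pos"
    by (rule bij_betwI[where g = "\<lambda>i. (eig i, i)"]) (auto simp: pos_indices_def)
  have s: "(\<lambda>(l, i). ?f i) summable_on Sigma (eig ` pos) eigenspace"
    using summable_on_reindex_bij_betw[OF b, of ?f] heat_term_summable[OF t] by (simp add: case_prod_unfold)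
  have "heat_kernel I eig \<phi> t x y = infsum (\<lambda>(l, i). ?f i) (Sigma (eig ` pos) eigenspace)"
    unfolding heat_kernel_def using infsum_reindex_bij_betw[OF b, of ?f] by (simp add: case_prod_unfold)
  also have "\<dots> = (\<Sum>\<^sub>\<infinity>l\<in>eig ` pos. \<Sum>\<^sub>\<infinity>i\<in>eigenspace l. ?f i)"
    by (rule infsum_Sigma'_banach[OF s, symmetric])
  also have "\<dots> = (\<Sum>\<^sub>\<infinity>l\<in>eig ` pos. of_real (exp (- t * l)) * (\<Sum>i\<in>eigenspace l. \<phi> i x * cnj (\<phi> i y)))"
  proof (intro infsum_cong)
    fix l assume "l \<in> eig ` pos"
    then have "finite (eigenspace l)" by (intro finite_eigenspace) (auto simp: pos_indices_def)
    then show "(\<Sum>\<^sub>\<infinity>i\<in>eigenspace l. ?f i) = of_real (exp (- t * l)) * (\<Sum>i\<in>eigenspace l. \<phi> i x * cnj (\<phi> i y))"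
      by (simp add: heat_term_eq sum_distrib_left)
  qed
  finally show ?thesis .
qed

lemma green_off_diagonal:
  assumes "x \<noteq> y"
  shows "green_exists I eig \<phi> x y"
    "((\<lambda>l. \<Sum>i\<in>eigenspace l. green_term eig \<phi> x y i) has_sum green_function I eig \<phi> x y) (eig ` pos)"
proof -
  obtain N where N: "\<And>F :: real \<Rightarrow> complex. ((\<lambda>l. F l * (\<Sum>i\<in>eigenspace l. \<phi> i x * cnj (\<phi> i y))) has_sum
      (\<Sum>k<N. F (lam y k) * of_real (haar y k x))) (eig ` pos)"
    by (rule off_diagonal[OF assms], erule that)
  define h where "h t = (\<Sum>\<^sub>\<infinity>k\<in>{..<N}. of_real (exp (- t * lam y k)) * complex_of_real (haar y k x))" for t
  have hk: "heat_kernel I eig \<phi> t x y = h t" if "t > 0" for t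
    unfolding heat_kernel_by_eigenvalue[OF that] h_def
    using infsumI[OF N[of "\<lambda>l. of_real (exp (- t * l))"]] by simp
  have fin: "(\<lambda>k. norm (complex_of_real (haar y k x)) / lam y k) summable_on {..<N}"
    by (rule summable_on_finite) simp
  note L = laplace_sum[of "{..<N}" "lam y", OF _ lam_pos fin, folded h_def]
  have hi: "set_integrable lborel {0<..} h" using L(1) by simp
  show "green_exists I eig \<phi> x y" unfolding green_exists_def
    using hi hk by (subst set_integrable_cong[OF refl refl, of _ _ h]) auto
  have "green_function I eig \<phi> x y = (LBINT t:{0<..}. h t)"
    unfolding green_function_def by (rule set_lebesgue_integral_cong) (auto simp: hk)
  also have "\<dots> = (\<Sum>k<N. of_real (inverse (lam y k)) * of_real (haar y k x))"
    using infsumI[OF L(2)] by simp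
  finally have g: "green_function I eig \<phi> x y = \<dots>" .
  show "((\<lambda>l. \<Sum>i\<in>eigenspace l. green_term eig \<phi> x y i) has_sum green_function I eig \<phi> x y) (eig ` pos)"
    unfolding g
    by (rule has_sum_cong[THEN iffD1, OF _ N[of "\<lambda>l. of_real (inverse l)"]]) (simp add: green_term_eq sum_distrib_left)
qed

lemma green_diag_nn_integral:
  "(\<integral>\<^sup>+t \<in> {0<..}. ennreal (Re (heat_kernel I eig \<phi> t x x)) \<partial>lborel) =
        (\<Sum>\<^sub>\<infinity>i \<in> pos. ennreal (inverse (eig i) * (norm (\<phi> i x))\<^sup>2))"
proof -
  have hk: "ennreal (Re (heat_kernel I eig \<phi> t x x)) = (\<integral>\<^sup>+i. ennreal (exp (- t * eig i) * (norm (\<phi> i x))\<^sup>2) \<partial>count_space pos)"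
    if t: "t > 0" for t
  proof -
    have "((\<lambda>i. complex_of_real (exp (- t * eig i) * (norm (\<phi> i x))\<^sup>2)) has_sum
       of_real (\<Sum>\<^sub>\<infinity>i\<in>pos. exp (- t * eig i) * (norm (\<phi> i x))\<^sup>2)) pos"
      by (intro has_sum_of_real has_sum_infsum heat_diag_summable t)
    then have "heat_kernel I eig \<phi> t x x = of_real (\<Sum>\<^sub>\<infinity>i\<in>pos. exp (- t * eig i) * (norm (\<phi> i x))\<^sup>2)"
      unfolding heat_kernel_eq of_real_mult complex_norm_square by (rule infsumI)
    then show ?thesis
      using ennreal_infsum[OF heat_diag_summable[OF t]] by (simp add: nn_integral_count_space_eq_infsum[OF countable_pos])
  qed
  have "(\<integral>\<^sup>+t \<in> {0<..}. ennreal (Re (heat_kernel I eig \<phi> t x x)) \<partial>lborel)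
     = (\<integral>\<^sup>+t. \<integral>\<^sup>+i. ennreal (exp (- t * eig i) * (norm (\<phi> i x))\<^sup>2) * indicator {0<..} t \<partial>count_space pos \<partial>lborel)"
    by (intro nn_integral_cong) (auto simp: hk indicator_def)
  also have "\<dots> = (\<integral>\<^sup>+i. \<integral>\<^sup>+t. ennreal (exp (- t * eig i) * (norm (\<phi> i x))\<^sup>2) * indicator {0<..} t \<partial>lborel \<partial>count_space pos)"
    by (rule nn_integral_count_space_nn_integral[OF countable_pos]) simp
  also have "\<dots> = (\<integral>\<^sup>+i. ennreal (inverse (eig i) * (norm (\<phi> i x))\<^sup>2) \<partial>count_space pos)"
  proof (intro nn_integral_cong)
    fix i assume "i \<in> space (count_space pos)"
    then have i: "eig i > 0" by (simp add: pos_indices_def)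
    have "(\<integral>\<^sup>+t. ennreal (exp (- t * eig i) * (norm (\<phi> i x))\<^sup>2) * indicator {0<..} t \<partial>lborel)
       = (\<integral>\<^sup>+t. ennreal ((norm (\<phi> i x))\<^sup>2) * (ennreal (exp (- t * eig i)) * indicator {0<..} t) \<partial>lborel)"
      by (intro nn_integral_cong) (simp add: ennreal_mult' mult_ac)
    also have "\<dots> = ennreal ((norm (\<phi> i x))\<^sup>2) * ennreal (1 / eig i)"
      by (subst nn_integral_cmult) (simp_all add: nn_integral_exp_decay[OF i, simplified])
    also have "\<dots> = ennreal (inverse (eig i) * (norm (\<phi> i x))\<^sup>2)"
      using i by (simp add: ennreal_mult'[symmetric] divide_inverse mult.commute)
    finally show "(\<integral>\<^sup>+t. ennreal (exp (- t * eig i) * (norm (\<phi> i x))\<^sup>2) * indicator {0<..} t \<partial>lborel) = \<dots>" .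
  qed
  finally show ?thesis unfolding nn_integral_count_space_eq_infsum[OF countable_pos] .
qed

end

section \<open>The Green function\<close>

theorem corollary4p6:
  fixes \<mu> :: "'a::metric_space measure"
    and s s0 :: real
    and I :: "'i set"
    and eig :: "'i \<Rightarrow> real"
    and \<phi> :: "'i \<Rightarrow> 'a \<Rightarrow> complex"
  assumes "ultrametric_cantor TYPE('a)"
    and "equitising TYPE('a)"
    and "zeta_regular TYPE('a) s0"
    and "connes_measure s0 \<mu>"
    and "measure_support \<mu> = UNIV"
    and "equity_measure \<mu>"
    and "s < 4"
    and "vp_test_eigenbasis \<mu> s I eig \<phi>"
    and "(\<lambda>i. inverse (eig i)) summable_on pos_indices I eig"
  shows
    "(\<forall>t>0. \<forall>x y. (heat_term eig \<phi> t x y) summable_on (pos_indices I eig)) \<and>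
     (AE x in \<mu>. x \<in> green_diag_finite I eig \<phi>) \<and>
     (\<forall>x \<in> green_diag_finite I eig \<phi>. \<forall>y \<in> green_diag_finite I eig \<phi>.
        green_exists I eig \<phi> x y \<and>
        ((green_term eig \<phi> x y) has_sum (green_function I eig \<phi> x y)) (pos_indices I eig)) \<and>
     (\<forall>x y. x \<noteq> y \<longrightarrow>
        green_exists I eig \<phi> x y \<and>
        (\<forall>l>0. finite {i \<in> I. eig i = l}) \<and>
        ((\<lambda>l. \<Sum>i \<in> {i \<in> I. eig i = l}. green_term eig \<phi> x y i)
           has_sum (green_function I eig \<phi> x y)) (eig ` pos_indices I eig)) \<and>
     (\<forall>x. (\<integral>\<^sup>+t \<in> {0<..}. ennreal (Re (heat_kernel I eig \<phi> t x x)) \<partial>lborel) =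
        (\<Sum>\<^sub>\<infinity>i \<in> pos_indices I eig. ennreal (inverse (eig i) * (norm (\<phi> i x))\<^sup>2)))"
proof -
  have "prob_space \<mu>" using assms(4) by (simp add: connes_measure_def)
  then interpret prob_space \<mu> .
  interpret vp_spectrum \<mu> s I eig \<phi>
    by unfold_locales (use assms in \<open>auto simp: connes_measure_def ultrametric_cantor_def\<close>)
  show ?thesis
    using heat_term_summable AE_green_diag_finite green_diag_finite_expansion green_off_diagonal
      finite_eigenspace(1) green_diag_nn_integral by blast
qed

end
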